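(* Let $\mathsf P$ and $\mathsf Q$ be polytopes in $\mathbb R^d$ in parallelogramic position. Then there is a linear isomorphism of cones $\mathbb{DC}(\mathsf P+\mathsf Q)\simeq\mathbb{DC}(\mathsf P)\times\mathbb{DC}(\mathsf Q)$. Moreover, the graph of edge dependencies $ED(\mathsf P+\mathsf Q)$ is the lift of the disjoint union $ED(\mathsf P)\cup ED(\mathsf Q)$ for the equivalence relation on the edges of $\mathsf P+\mathsf Q$ whose equivalence classes are the edge classes.
   Context: Deformation cone: a polytope $\mathsf R$ is a deformation of a polytope $\mathsf P$ if $\lambda\mathsf P=\mathsf R+\mathsf R'$ for some $\lambda>0$ and polytope $\mathsf R'$. Then each vertex $p$ of $\mathsf P$ has an associated vertex $q(p)$ of $\mathsf R$ (maximized by the same linear functionals), and for every edge $e=pp'$ of $\mathsf P$ there is $\lambda_e\ge0$ with $q(p)-q(p')=\lambda_e(p-p')$. The vector $(\lambda_e)_e\in\mathbb R_{\ge0}^{E(\mathsf P)}$ is the edge-deformation vector of $\mathsf R$, and $\mathbb{DC}(\mathsf P)$ is the cone of edge-deformation vectors of all deformations of $\mathsf P$. The graph of edge dependencies $ED(\mathsf P)$ has node set $E(\mathsf P)$, with an arc $ef$ (loops included) if $\lambda_e=\lambda_f$ for all $\lambda\in\mathbb{DC}(\mathsf P)$. Parallelogramic position: a vector $v$ is $2$-generic with respect to $\mathsf P$ if it is not parallel to any $2$-face of $\mathsf P$, i.e. there are no two edges $xy$, $ab$ in a common $2$-face of $\mathsf P$ such that $v=\alpha(y-x)+\beta(b-a)$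 with $\alpha,\beta\in\mathbb R$. $\mathsf P$ and $\mathsf Q$ are in parallelogramic position if every edge direction of $\mathsf P$ is $2$-generic with respect to $\mathsf Q$ and every edge direction of $\mathsf Q$ is $2$-generic with respect to $\mathsf P$, and no edge of $\mathsf P$ is parallel to an edge of $\mathsf Q$ (the last condition only matters when both are segments). In this case every edge of $\mathsf P+\mathsf Q$ is of the form $e+x$ with $e$ an edge of one of $\mathsf P,\mathsf Q$ and $x$ a vertex of the other. For an edge $e$ of $\mathsf P$ (resp. $\mathsf Q$), its edge class $C_e$ is the set of edges of $\mathsf P+\mathsf Q$ of the form $e+x$ with $x$ a vertex of $\mathsf Q$ (resp. $\mathsf P$); edge classes partition $E(\mathsf P+\mathsf Q)$ and are indexed by $E(\mathsf P)\sqcup E(\mathsf Q)$. If $\sim$ is an equivalence relation on a set $N$ and $G$ is a graph (possibly with loops) on $N/{\sim}$, the lift of $G$ is the graph on $N$ with an arc $xy$ whenever there is an arc between $[x]$ and $[y]$ in $G$. *)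

theory Defs
  imports "HOL-Analysis.Analysis" "HOL-Analysis.Finite_Function_Topology"
begin

definition edge_set :: "'a::euclidean_space set \<Rightarrow> 'a set set" where
  "edge_set P = {e. e edge_of P}"

(* Set addition is Minkowski addition throughout.  If P is nonempty, then so are R and R'. *)
definition deformation_of :: "'a::euclidean_space set \<Rightarrow> 'a set \<Rightarrow> bool" where
  "deformation_of R P \<longleftrightarrow>
     polytope R \<and> (\<exists>c>0. \<exists>R'. polytope R' \<and> (\<lambda>x. c *\<^sub>R x) ` P = R + R')"

(* Every linear functional that is maximized over P at p is maximized over R at q. *)
definition associated_vertex :: "'a::euclidean_space set \<Rightarrow> 'a set \<Rightarrow> 'a \<Rightarrow> 'a \<Rightarrow> bool" where
  "associated_vertex P R p q \<longleftrightarrow>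
     q extreme_point_of R \<and>
     (\<forall>c. (\<forall>x\<in>P. c \<bullet> x \<le> c \<bullet> p) \<longrightarrow> (\<forall>y\<in>R. c \<bullet> y \<le> c \<bullet> q))"

(* A polytope has finitely many edges, so the coordinate space of edge-indexed vectors of P is
   the subspace of finitely supported functions whose support consists of edges of P.
   Whenever closed_segment p p' is an edge of P, the points p and p' are distinct vertices of P. *)
definition edge_deformation_vector ::
  "'a::euclidean_space set \<Rightarrow> 'a set \<Rightarrow> ('a set \<Rightarrow>\<^sub>0 real) \<Rightarrow> bool" where
  "edge_deformation_vector P R l \<longleftrightarrow>
     Poly_Mapping.keys l \<subseteq> edge_set P \<and>
     (\<exists>q. (\<forall>p. p extreme_point_of P \<longrightarrow> associated_vertex P R p (q p)) \<and>
          (\<forall>p p'. closed_segment p p' \<in> edge_set P \<longrightarrow>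
             0 \<le> Poly_Mapping.lookup l (closed_segment p p') \<and>
             q p - q p' = Poly_Mapping.lookup l (closed_segment p p') *\<^sub>R (p - p')))"

definition deformation_cone :: "'a::euclidean_space set \<Rightarrow> ('a set \<Rightarrow>\<^sub>0 real) set" where
  "deformation_cone P = {l. \<exists>R. deformation_of R P \<and> edge_deformation_vector P R l}"

(* Injectivity is required on the linear span, so f restricts to a linear isomorphism
   from span C onto span D that maps C onto D. *)
definition linear_cone_isomorphism ::
  "('v::real_vector \<Rightarrow> 'w::real_vector) \<Rightarrow> 'v set \<Rightarrow> 'w set \<Rightarrow> bool" where
  "linear_cone_isomorphism f C D \<longleftrightarrow> linear f \<and> inj_on f (span C) \<and> f ` C = D"

(* A graph with loops: node set and symmetric set of arcs. *)
type_synonym 'v loop_graph = "'v set \<times> ('v \<times> 'v) set"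

definition edge_dependencies :: "'a::euclidean_space set \<Rightarrow> 'a set loop_graph" where
  "edge_dependencies P =
     (edge_set P,
      {(e, f). e \<in> edge_set P \<and> f \<in> edge_set P \<and>
               (\<forall>l\<in>deformation_cone P. Poly_Mapping.lookup l e = Poly_Mapping.lookup l f)})"

definition disjoint_union_graph ::
  "'v loop_graph \<Rightarrow> 'w loop_graph \<Rightarrow> ('v + 'w) loop_graph" where
  "disjoint_union_graph G H =
     (fst G <+> fst H, map_prod Inl Inl ` snd G \<union> map_prod Inr Inr ` snd H)"

definition relabel_graph :: "('v \<Rightarrow> 'w) \<Rightarrow> 'v loop_graph \<Rightarrow> 'w loop_graph" where
  "relabel_graph h G = (h ` fst G, map_prod h h ` snd G)"

(* Here r is an equivalence relation on N and G is a graph with node set N // r. *)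
definition lift_graph :: "'v set \<Rightarrow> ('v \<times> 'v) set \<Rightarrow> 'v set loop_graph \<Rightarrow> 'v loop_graph" where
  "lift_graph N r G = (N, {(x, y). x \<in> N \<and> y \<in> N \<and> (r `` {x}, r `` {y}) \<in> snd G})"

definition two_generic :: "'a::euclidean_space set \<Rightarrow> 'a \<Rightarrow> bool" where
  "two_generic P v \<longleftrightarrow>
     \<not> (\<exists>F x y a b. F face_of P \<and> aff_dim F = 2 \<and>
          closed_segment x y \<in> edge_set P \<and> closed_segment x y \<subseteq> F \<and>
          closed_segment a b \<in> edge_set P \<and> closed_segment a b \<subseteq> F \<and>
          (\<exists>\<alpha> \<beta>. v = \<alpha> *\<^sub>R (y - x) + \<beta> *\<^sub>R (b - a)))"

definition parallelogramic_position ::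
  "'a::euclidean_space set \<Rightarrow> 'a set \<Rightarrow> bool" where
  "parallelogramic_position P Q \<longleftrightarrow>
     (\<forall>x y. closed_segment x y \<in> edge_set P \<longrightarrow> two_generic Q (y - x)) \<and>
     (\<forall>x y. closed_segment x y \<in> edge_set Q \<longrightarrow> two_generic P (y - x)) \<and>
     (\<forall>x y a b. closed_segment x y \<in> edge_set P \<longrightarrow> closed_segment a b \<in> edge_set Q \<longrightarrow>
        \<not> (\<exists>\<alpha>. y - x = \<alpha> *\<^sub>R (b - a)))"

(* Inl indexes the classes of edges of P and Inr those of edges of Q. *)
fun edge_class ::
  "'a::euclidean_space set \<Rightarrow> 'a set \<Rightarrow> 'a set + 'a set \<Rightarrow> 'a set set" where
  "edge_class P Q (Inl e) = {g \<in> edge_set (P + Q). \<exists>x. x extreme_point_of Q \<and> g = e + {x}}"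
| "edge_class P Q (Inr e) = {g \<in> edge_set (P + Q). \<exists>x. x extreme_point_of P \<and> g = e + {x}}"

definition same_edge_class ::
  "'a::euclidean_space set \<Rightarrow> 'a set \<Rightarrow> ('a set \<times> 'a set) set" where
  "same_edge_class P Q =
     {(g, h). \<exists>i \<in> edge_set P <+> edge_set Q. g \<in> edge_class P Q i \<and> h \<in> edge_class P Q i}"

end

(* A vector of edge lengths on a polytope S is in the deformation cone iff it is nonnegative and
   has a potential: a map q on the vertices with q p - q p' = l(pp') (p - p') on every edge.
   Indeed, improving paths show that the hull of the points q p is a weak summand, the hull of
   the points k p - q p being its complement for large k. A potential exists as soon as one
   exists on every polygonal face. In P + Q, the 2-faces are translates of 2-faces of P or Q and
   parallelograms e + f. The parallelograms force lengths to be constant on edge classes, and the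
   translated polygons transport potentials from P + Q to the 2-faces of P and Q; conversely
   potentials on P and Q add up to one on P + Q. *)
theory Submission
  imports Defs
begin

section \<open>Faces of maximizers and pivoting\<close>

text \<open>A polygon of \<open>P\<close> reappears in \<open>P + Q\<close> at some vertex of
  \<open>Q\<close>, but different polygons may reappear at different vertices, and \<open>P\<close>
  itself need not be a translate of any face of \<open>P + Q\<close>. A potential on
  \<open>P + Q\<close> thus yields potentials on single polygons of \<open>P\<close> that need not
  fit together. Only the edge lengths agree, once they are constant on edge classes; hence the
  existence of a potential has to be reduced to a condition on polygons. The geometric tool
  throughout is pivoting, as in the simplex method: the functional exposing a face is tilted towards
  \<open>c\<close> until a new vertex ties. At a vertex this gives an improving edge; at an edge it
  gives the polygons that link two improving edges, and the parallelograms that link two members of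
  an edge class. In both uses a finite ranking decreases, so that chains of such polygons end where
  they should.\<close>

definition max_face :: "'a::euclidean_space \<Rightarrow> 'a set \<Rightarrow> 'a set" where
  "max_face c S = {x \<in> S. \<forall>y\<in>S. c \<bullet> y \<le> c \<bullet> x}"

lemma max_faceI: "x \<in> S \<Longrightarrow> (\<And>y. y \<in> S \<Longrightarrow> c \<bullet> y \<le> c \<bullet> x) \<Longrightarrow> x \<in> max_face c S"
  by (simp add: max_face_def)

lemma max_face_subset: "max_face c S \<subseteq> S"
  by (auto simp: max_face_def)

lemma max_face_le: "x \<in> max_face c S \<Longrightarrow> y \<in> S \<Longrightarrow> c \<bullet> y \<le> c \<bullet> x"
  by (simp add: max_face_def)

lemma max_face_eq: "x \<in> max_face c S \<Longrightarrow> y \<in> max_face c S \<Longrightarrow> c \<bullet> y = c \<bullet> x"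
  by (simp add: max_face_def order_antisym)

lemma max_face_less:
  assumes "x \<in> max_face c S" "y \<in> S" "y \<notin> max_face c S"
  shows "c \<bullet> y < c \<bullet> x"
proof -
  obtain z where "z \<in> S" "c \<bullet> y < c \<bullet> z" using assms by (auto simp: max_face_def not_le)
  then show ?thesis using max_face_le[OF assms(1)] by fastforce
qed

lemma max_face_face_of:
  assumes "convex S"
  shows "max_face c S face_of S"
proof (cases "max_face c S = {}")
  case False
  then obtain z where z: "z \<in> max_face c S" by auto
  then have "max_face c S = S \<inter> {x. c \<bullet> x = c \<bullet> z}"
    by (fastforce simp: max_face_def)
  then show ?thesis
    using face_of_Int_supporting_hyperplane_le[OF assms, of c "c \<bullet> z"] z max_face_le by force
qed auto

lemma max_face_nonempty:
  assumes "polytope S" "S \<noteq> {}"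
  shows "max_face c S \<noteq> {}"
proof -
  have "continuous_on S (\<lambda>x. c \<bullet> x)" by (intro continuous_intros)
  then obtain x where "x \<in> S" "\<forall>y\<in>S. c \<bullet> y \<le> c \<bullet> x"
    using continuous_attains_sup[of S "\<lambda>x. c \<bullet> x"] assms polytope_imp_compact by blast
  then show ?thesis by (auto simp: max_face_def)
qed

text \<open>Faces of polyhedra are exposed, and for nonempty \<open>F\<close> the bound of the
  supporting hyperplane is attained, hence is the maximum.\<close>

lemma face_is_max_face:
  assumes "polytope S" "F face_of S" "F \<noteq> {}"
  obtains c where "F = max_face c S"
proof -
  have "F exposed_face_of S"
    using assms exposed_face_of_polyhedron polytope_imp_polyhedron by blast
  then obtain a b where "S \<subseteq> {x. a \<bullet> x \<le> b}" "F = S \<inter> {x. a \<bullet> x = b}"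
    by (auto simp: exposed_face_of_def)
  then have "F = max_face a S"
    using assms(3) by (force simp: max_face_def)
  then show ?thesis using that by blast
qed

lemma max_face_plusD:
  assumes z: "x + y \<in> max_face c (P + Q)" and xy: "x \<in> P" "y \<in> Q"
  shows "x \<in> max_face c P \<and> y \<in> max_face c Q"
proof -
  have "c \<bullet> x' \<le> c \<bullet> x" if "x' \<in> P" for x'
    using max_face_le[OF z, of "x' + y"] that xy by (auto simp: inner_add_right)
  moreover have "c \<bullet> y' \<le> c \<bullet> y" if "y' \<in> Q" for y'
    using max_face_le[OF z, of "x + y'"] that xy by (auto simp: inner_add_right)
  ultimately show ?thesis using xy by (auto intro!: max_faceI)
qed

text \<open>A linear functional is maximized over a sum by maximizing both terms independently. All
  knowledge about the faces of \<open>P + Q\<close> comes from this.\<close>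

lemma max_face_plus:
  assumes "P \<noteq> {}" "Q \<noteq> {}"
  shows "max_face c (P + Q) = max_face c P + max_face c Q"
proof
  show "max_face c (P + Q) \<subseteq> max_face c P + max_face c Q"
  proof
    fix z assume z: "z \<in> max_face c (P + Q)"
    then obtain x y where xy: "z = x + y" "x \<in> P" "y \<in> Q"
      by (auto simp: max_face_def elim!: set_plus_elim)
    then have "x \<in> max_face c P" "y \<in> max_face c Q" using z max_face_plusD by blast+
    then show "z \<in> max_face c P + max_face c Q" using xy(1) by blast
  qed
  show "max_face c P + max_face c Q \<subseteq> max_face c (P + Q)"
  proof
    fix z assume "z \<in> max_face c P + max_face c Q"
    then obtain x y where xy: "z = x + y" "x \<in> max_face c P" "y \<in> max_face c Q"
      by (rule set_plus_elim)
    have "z \<in> P + Q" using xy max_face_subset by (metis set_plus_intro subsetD)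
    moreover have "c \<bullet> z' \<le> c \<bullet> z" if "z' \<in> P + Q" for z'
      using that xy by (elim set_plus_elim) (simp add: inner_add_right add_mono max_face_le)
    ultimately show "z \<in> max_face c (P + Q)" by (rule max_faceI)
  qed
qed

lemma max_face_const:
  assumes "\<And>x y. x \<in> S \<Longrightarrow> y \<in> S \<Longrightarrow> c \<bullet> x = c \<bullet> y"
  shows "max_face c S = S"
proof
  show "S \<subseteq> max_face c S"
    using assms by (intro subsetI max_faceI) (simp_all add: order_eq_iff)
qed (rule max_face_subset)

lemma finite_vertices: "polytope (S :: 'a::euclidean_space set) \<Longrightarrow> finite {v. v extreme_point_of S}"
  using finite_polyhedron_extreme_points polytope_imp_polyhedron by blast

lemma convex_hull_vertices: "polytope (S :: 'a::euclidean_space set) \<Longrightarrow> convex hull {v. v extreme_point_of S} = S"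
  using Krein_Milman_Minkowski[of S] polytope_imp_compact polytope_imp_convex by auto

lemma inner_le_vertices:
  fixes S :: "'a::euclidean_space set"
  assumes "polytope S" "\<And>v. v extreme_point_of S \<Longrightarrow> c \<bullet> v \<le> k" "x \<in> S"
  shows "c \<bullet> x \<le> k"
proof -
  have "convex hull {v. v extreme_point_of S} \<subseteq> {x. c \<bullet> x \<le> k}"
    using assms(2) by (intro hull_minimal) (auto simp: convex_halfspace_le)
  then show ?thesis using assms convex_hull_vertices by blast
qed

lemma polytope_max_vertex:
  fixes S :: "'a::euclidean_space set"
  assumes "polytope S" "S \<noteq> {}"
  obtains v where "v extreme_point_of S" "v \<in> max_face c S"
proof -
  have "polytope (max_face c S)"
    using assms max_face_face_of polytope_imp_convex face_of_polytope_polytope by blast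
  moreover have "max_face c S \<noteq> {}" using assms max_face_nonempty by blast
  ultimately obtain v where "v extreme_point_of max_face c S"
    using extreme_point_exists_convex[of "max_face c S"] polytope_imp_compact polytope_imp_convex by metis
  then show ?thesis
    using that extreme_point_of_face[OF max_face_face_of] assms polytope_imp_convex by blast
qed

lemma vertex_exposing:
  fixes S :: "'a::euclidean_space set"
  assumes "polytope S" "v extreme_point_of S"
  obtains d where "\<And>x. x \<in> S \<Longrightarrow> x \<noteq> v \<Longrightarrow> d \<bullet> x < d \<bullet> v"
proof -
  obtain d where d: "{v} = max_face d S"
    using assms face_is_max_face[of S "{v}"] by (auto simp: face_of_singleton)
  show ?thesis
    by (rule that[of d], rule max_face_less) (use d in auto)
qed

text \<open>Tilt a functional \<open>d\<close> exposing \<open>F\<close> towards \<open>c\<close> as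
  far as \<open>F\<close> stays optimal. Points that become tied with \<open>F\<close> were strictly
  below it for \<open>d\<close>, so \<open>c\<close> must be larger on them than on
  \<open>F\<close>. In a minimal face of this kind \<open>F\<close> is a facet, which gives the
  dimension.\<close>

lemma pivot:
  fixes S :: "'a::euclidean_space set"
  assumes S: "polytope S" and F: "F face_of S" "F \<noteq> {}"
    and k: "\<And>x. x \<in> F \<Longrightarrow> c \<bullet> x = k" and x0: "x0 \<in> S" "c \<bullet> x0 > k"
  obtains G where "G face_of S" "F \<subseteq> G" "aff_dim G = aff_dim F + 1"
    "\<And>x. x \<in> G \<Longrightarrow> x \<notin> F \<Longrightarrow> c \<bullet> x > k"
proof -
  let ?P = "\<lambda>G. G face_of S \<and> F \<subset> G \<and> (\<forall>x\<in>G - F. c \<bullet> x > k)"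
  obtain d where d: "F = max_face d S" using S F face_is_max_face by blast
  obtain y where y: "y \<in> F" using F by auto
  define M where "M = d \<bullet> y"
  have dM: "d \<bullet> x = M" if "x \<in> F" for x
    using that y d max_face_eq by (metis M_def)
  have dle: "d \<bullet> x \<le> M" if "x \<in> S" for x
    using that y d max_face_le M_def by metis
  have dlt: "d \<bullet> x < M" if "x \<in> S" "x \<notin> F" for x
    using that y d max_face_less M_def by metis
  define V where "V = {v. v extreme_point_of S \<and> c \<bullet> v > k}"
  have finV: "finite V" unfolding V_def using finite_vertices[OF S] by simp
  have "V \<noteq> {}"
    using inner_le_vertices[OF S, of c k x0] x0 by (force simp: V_def)
  \<comment> \<open>The ratio test: \<open>r v\<close> is the \<open>t\<close> for which
    \<open>v\<close> ties with \<open>F\<close> under \<open>d + t *\<^sub>R c\<close>. Vertices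
    with \<open>c \<bullet> v \<le> k\<close> impose no bound on \<open>t\<close>.\<close>
  define r where "r v = (M - d \<bullet> v) / (c \<bullet> v - k)" for v
  define t where "t = Min (r ` V)"
  obtain v0 where v0: "v0 \<in> V" "t = r v0"
    using finV \<open>V \<noteq> {}\<close> Min_in[of "r ` V"] that unfolding t_def by blast
  have VS: "v \<in> S" "v \<notin> F" if "v \<in> V" for v
    using that k unfolding V_def by (auto simp: extreme_point_of_def)
  have "t > 0" using v0 dlt VS by (auto simp: r_def V_def)
  have tle: "t \<le> r v" if "v \<in> V" for v
    using that finV t_def by simp
  define d' where "d' = d + t *\<^sub>R c"
  have vle: "d' \<bullet> v \<le> M + t * k" if v: "v extreme_point_of S" for v
  proof (cases "c \<bullet> v > k")
    case True
    then have "t * (c \<bullet> v - k) \<le> M - d \<bullet> v"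
      using tle[of v] v by (simp add: V_def r_def pos_le_divide_eq)
    then show ?thesis by (simp add: d'_def inner_add_left algebra_simps)
  next
    case False
    then have "t * (c \<bullet> v) \<le> t * k" using \<open>t > 0\<close> by simp
    moreover have "d \<bullet> v \<le> M" using dle v by (auto simp: extreme_point_of_def)
    ultimately show ?thesis by (simp add: d'_def inner_add_left)
  qed
  have le: "d' \<bullet> x \<le> M + t * k" if "x \<in> S" for x
    using inner_le_vertices[OF S vle that] .
  define G0 where "G0 = S \<inter> {x. d' \<bullet> x = M + t * k}"
  have "G0 face_of S" unfolding G0_def
    by (rule face_of_Int_supporting_hyperplane_le) (use S le polytope_imp_convex in auto)
  moreover have "F \<subset> G0"
  proof -
    have "F \<subseteq> G0" unfolding G0_def d'_def
      using dM k face_of_imp_subset[OF F(1)] by (auto simp: inner_add_left)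
    moreover have "c \<bullet> v0 - k > 0" using v0 by (simp add: V_def)
    then have "v0 \<in> G0" using VS[OF v0(1)] v0
      by (simp add: G0_def d'_def inner_add_left r_def) (simp add: field_simps)
    ultimately show ?thesis using VS[OF v0(1)] by blast
  qed
  moreover have "c \<bullet> x > k" if "x \<in> G0 - F" for x
  proof -
    have "d \<bullet> x + t * (c \<bullet> x) = M + t * k" "d \<bullet> x < M"
      using that dlt by (auto simp: G0_def d'_def inner_add_left)
    then have "t * (c \<bullet> x) > t * k" by linarith
    then show ?thesis using \<open>t > 0\<close> by simp
  qed
  ultimately have "?P G0" by blast
  \<comment> \<open>Several vertices may attain the minimal ratio, so \<open>G0\<close> can be too
    large; an inclusion-minimal candidate has the right dimension.\<close>
  moreover have "finite {G. ?P G}"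
    by (rule finite_subset[OF _ finite_polytope_faces[OF S]]) auto
  ultimately obtain G where "G \<in> {G. ?P G}" "\<forall>H\<in>{G. ?P G}. H \<subseteq> G \<longrightarrow> G = H"
    using finite_has_minimal[of "{G. ?P G}"] by blast
  then have G: "?P G" and min: "\<And>H. ?P H \<Longrightarrow> H \<subseteq> G \<Longrightarrow> H = G"
    by blast+
  have "F face_of G" using G F face_of_face by blast
  have pG: "polytope G" using G S face_of_polytope_polytope by blast
  obtain H where H: "H facet_of G" "F \<subseteq> H"
    using face_of_polyhedron_subset_facet[of G F] \<open>F face_of G\<close> pG F G polytope_imp_polyhedron by blast
  have "H = F"
  proof (rule ccontr)
    assume "H \<noteq> F"
    moreover have "H face_of S" using H G facet_of_imp_face_of face_of_trans by blast
    moreover have "H \<subseteq> G" using H facet_of_imp_subset by blast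
    ultimately have "?P H" using H G by blast
    then have "H = G" using min \<open>H \<subseteq> G\<close> by blast
    then show False using H by simp
  qed
  then have "aff_dim F = aff_dim G - 1" using H by (simp add: facet_of_def)
  then show ?thesis using that[of G] G by auto
qed

section \<open>Edges as segments between vertices, and improving edges\<close>

lemma segment_of_dim_1:
  fixes G :: "'a::euclidean_space set"
  assumes "polytope G" "aff_dim G = 1"
  obtains a b where "G = closed_segment a b" "a \<noteq> b"
proof -
  have "collinear G" "compact G" "convex G" "G \<noteq> {}"
    using assms by (auto simp: collinear_aff_dim polytope_imp_compact polytope_imp_convex)
  then obtain a b where "G = closed_segment a b" using compact_convex_collinear_segment by blast
  moreover have "a \<noteq> b" using assms calculation by auto
  ultimately show ?thesis using that by blast
qed

lemma aff_dim_segment: "a \<noteq> b \<Longrightarrow> aff_dim (closed_segment a b) = 1" for a b :: "'a::euclidean_space"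
  by (simp add: segment_convex_hull aff_dim_convex_hull aff_dim_2)

lemma edge_set_segment:
  "closed_segment a b \<in> edge_set S \<longleftrightarrow> closed_segment a b face_of S \<and> a \<noteq> b"
  by (auto simp: edge_set_def edge_of_def aff_dim_segment)

lemma edge_set_vertices:
  fixes S :: "'a::euclidean_space set"
  assumes "closed_segment a b \<in> edge_set S"
  shows "a extreme_point_of S" "b extreme_point_of S"
  using assms by (auto simp: edge_set_segment dest!: extreme_point_of_face[of _ S] simp: extreme_point_of_segment)

lemma edge_set_subset: "closed_segment a b \<in> edge_set S \<Longrightarrow> a \<in> S \<and> b \<in> S"
  using edge_set_vertices extreme_point_of_def by metis

lemma edge_setE:
  fixes S :: "'a::euclidean_space set"
  assumes "polytope S" "e \<in> edge_set S"
  obtains a b where "e = closed_segment a b" "a \<noteq> b" "a extreme_point_of S" "b extreme_point_of S"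
proof -
  have "polytope e" "aff_dim e = 1"
    using assms face_of_polytope_polytope by (auto simp: edge_set_def edge_of_def)
  then obtain a b where "e = closed_segment a b" "a \<noteq> b" using segment_of_dim_1 by blast
  then show ?thesis using that edge_set_vertices assms(2) by metis
qed

lemma edge_set_face:
  assumes "F face_of S" shows "edge_set F = {e \<in> edge_set S. e \<subseteq> F}"
  using face_of_face[OF assms] by (auto simp: edge_set_def edge_of_def)

lemma finite_edge_set: "polytope S \<Longrightarrow> finite (edge_set S)"
  by (rule finite_subset[OF _ finite_polytope_faces]) (auto simp: edge_set_def edge_of_def)

text \<open>Pivoting about the face \<open>{w}\<close> yields a one-dimensional face on which
  \<open>c\<close> increases away from \<open>w\<close>.\<close>

lemma improving_edge:
  fixes S :: "'a::euclidean_space set"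
  assumes S: "polytope S" and w: "w extreme_point_of S" and x: "x \<in> S" "c \<bullet> x > c \<bullet> w"
  obtains a where "closed_segment w a \<in> edge_set S" "c \<bullet> a > c \<bullet> w"
proof -
  obtain G where G: "G face_of S" "{w} \<subseteq> G" "aff_dim G = aff_dim {w} + 1"
    "\<And>x. x \<in> G \<Longrightarrow> x \<notin> {w} \<Longrightarrow> c \<bullet> x > c \<bullet> w"
    using pivot[of S "{w}" c "c \<bullet> w" x] assms by (auto simp: face_of_singleton)
  then have d1: "aff_dim G = 1" by simp
  obtain a b where ab: "G = closed_segment a b" "a \<noteq> b"
    using segment_of_dim_1[OF _ d1] G S face_of_polytope_polytope by blast
  have "w extreme_point_of G" using w G extreme_point_of_face by blast
  then have "w = a \<or> w = b" using ab extreme_point_of_segment by blast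
  then obtain y where y: "G = closed_segment w y" "y \<noteq> w"
    using ab closed_segment_commute by blast
  show ?thesis
    by (rule that[of y]) (use y G edge_set_segment in \<open>auto\<close>)
qed

lemma edge_at_vertex:
  fixes S :: "'a::euclidean_space set"
  assumes S: "polytope S" and w: "w extreme_point_of S" and x: "x \<in> S" "x \<noteq> w"
  obtains a where "closed_segment w a \<in> edge_set S"
proof -
  have "(x - w) \<bullet> x > (x - w) \<bullet> w"
    using x(2) inner_gt_zero_iff[of "x - w"] by (simp add: inner_diff_right)
  then show ?thesis using improving_edge[OF S w x(1)] that by blast
qed

section \<open>Edge potentials\<close>

text \<open>Each improving edge strictly shrinks the finite set of vertices with larger
  \<open>c\<close>-value, so such paths end at a maximizer. The base case covers every maximizing
  vertex, since \<open>c\<close> need not be generic.\<close>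

lemma improving_edge_induct [consumes 2, case_names max step]:
  fixes S :: "'a::euclidean_space set"
  assumes S: "polytope S" and v: "v extreme_point_of S"
    and max: "\<And>x. x extreme_point_of S \<Longrightarrow> x \<in> max_face c S \<Longrightarrow> Pr x"
    and step: "\<And>x a. closed_segment x a \<in> edge_set S \<Longrightarrow> c \<bullet> x < c \<bullet> a \<Longrightarrow> Pr a \<Longrightarrow> Pr x"
  shows "Pr v"
  using v
proof (induction "card {y. y extreme_point_of S \<and> c \<bullet> v < c \<bullet> y}" arbitrary: v rule: less_induct)
  case less
  show ?case
  proof (cases "v \<in> max_face c S")
    case True
    then show ?thesis using max less.prems by blast
  next
    case False
    have "v \<in> S" using less.prems by (simp add: extreme_point_of_def)
    then obtain x where "x \<in> S" "c \<bullet> v < c \<bullet> x"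
      using False by (auto simp: max_face_def not_le)
    then obtain a where a: "closed_segment v a \<in> edge_set S" "c \<bullet> v < c \<bullet> a"
      using improving_edge[OF S less.prems] by blast
    have "{y. y extreme_point_of S \<and> c \<bullet> a < c \<bullet> y} \<subset> {y. y extreme_point_of S \<and> c \<bullet> v < c \<bullet> y}"
      using a edge_set_vertices(2)[OF a(1)] by force
    moreover have "finite {y. y extreme_point_of S \<and> c \<bullet> v < c \<bullet> y}"
      using finite_vertices[OF S] by simp
    ultimately have "Pr a"
      using less.hyps[of a] psubset_card_mono edge_set_vertices(2)[OF a(1)] by blast
    then show ?thesis using step a by blast
  qed
qed

text \<open>The functionals that identify two points of \<open>V\<close> fill only finitely many
  hyperplanes, a negligible set.\<close>

lemma generic_functional:
  fixes V :: "'a::euclidean_space set"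
  assumes "finite V"
  obtains c :: 'a where "inj_on ((\<bullet>) c) V"
proof -
  let ?B = "\<Union>p\<in>{p \<in> V \<times> V. fst p \<noteq> snd p}. {c. (fst p - snd p) \<bullet> c = 0}"
  have "negligible ?B"
    using assms by (intro negligible_Union) (auto intro!: negligible_hyperplane)
  then have "?B \<noteq> UNIV" using non_negligible_UNIV by metis
  then obtain c where c: "c \<notin> ?B" by blast
  have "inj_on ((\<bullet>) c) V"
  proof (rule inj_onI, rule ccontr)
    fix x y assume xy: "x \<in> V" "y \<in> V" "c \<bullet> x = c \<bullet> y" "x \<noteq> y"
    then have "(x - y) \<bullet> c = 0" using inner_commute by (metis inner_diff_left right_minus_eq)
    then have "c \<in> ?B" using xy by (intro UN_I[of "(x, y)"]) auto
    then show False using c by blast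
  qed
  then show ?thesis using that by blast
qed

text \<open>Here \<open>l\<close> is any function on sets, so the same \<open>l\<close> can be used
  on every face of \<open>S\<close>. Signs are left free: existence of a potential is a linear
  matter, and nonnegativity is only needed for turning it into a deformation.\<close>

definition edge_potential ::
  "'a::euclidean_space set \<Rightarrow> ('a set \<Rightarrow> real) \<Rightarrow> ('a \<Rightarrow> 'a) \<Rightarrow> bool" where
  "edge_potential S l q \<longleftrightarrow>
     (\<forall>p p'. closed_segment p p' \<in> edge_set S \<longrightarrow> q p - q p' = l (closed_segment p p') *\<^sub>R (p - p'))"

lemma edge_potentialD:
  "edge_potential S l q \<Longrightarrow> closed_segment p p' \<in> edge_set S \<Longrightarrow>
     q p - q p' = l (closed_segment p p') *\<^sub>R (p - p')"
  by (simp add: edge_potential_def)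

text \<open>Let \<open>d\<close> expose the edge \<open>w a0\<close>, and rank an improving edge \<open>w a\<close> by the \<open>r\<close> for which
  \<open>d + r *\<^sub>R c\<close> is constant on it. Pivoting with that functional about \<open>w a\<close> leads to a polygon on
  which \<open>w\<close> is still the \<open>c\<close>-minimum and whose other improving edge at \<open>w\<close> has a smaller rank;
  rank zero characterizes \<open>w a0\<close>.\<close>
lemma improving_edges_connected:
  fixes S :: "'a::euclidean_space set"
  assumes S: "polytope S"
    and a0: "closed_segment w a0 \<in> edge_set S" "c \<bullet> w < c \<bullet> a0"
    and a: "closed_segment w a \<in> edge_set S" "c \<bullet> w < c \<bullet> a"
    and step: "\<And>G a b. G face_of S \<Longrightarrow> aff_dim G = 2 \<Longrightarrow> closed_segment w a \<in> edge_set G \<Longrightarrow>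
       closed_segment w b \<in> edge_set G \<Longrightarrow> (\<And>x. x \<in> G \<Longrightarrow> x \<noteq> w \<Longrightarrow> c \<bullet> w < c \<bullet> x) \<Longrightarrow> val a = val b"
  shows "val a = val a0"
proof -
  have "closed_segment w a0 face_of S" using a0 edge_set_segment by blast
  then obtain d where d: "closed_segment w a0 = max_face d S"
    using face_is_max_face[OF S] by (metis ends_in_segment(1) empty_iff)
  have dw: "w \<in> max_face d S" "a0 \<in> max_face d S" using d[symmetric] by auto
  define r where "r x = d \<bullet> (w - x) / (c \<bullet> (x - w))" for x
  let ?I = "\<lambda>a. {b. closed_segment w b \<in> edge_set S \<and> c \<bullet> w < c \<bullet> b \<and> r b < r a}"
  show ?thesis
    using a
  proof (induction "card (?I a)" arbitrary: a rule: less_induct)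
    case less
    note a = less.prems
    have aV: "a extreme_point_of S" "w extreme_point_of S"
      using a edge_set_vertices by blast+
    show ?case
    proof (cases "a = a0")
      case False
      have "a \<notin> closed_segment w a0"
        using extreme_point_of_face[of "closed_segment w a0" S a] a a0 aV False
        by (auto simp: edge_set_segment extreme_point_of_segment)
      then have "d \<bullet> a < d \<bullet> w"
        using max_face_less[OF dw(1)] d aV by (auto simp: extreme_point_of_def)
      then have r0: "r a > 0" using a by (simp add: r_def inner_diff_right)
      define c' where "c' = d + r a *\<^sub>R c"
      have c'a: "c' \<bullet> a = c' \<bullet> w" using a
        by (simp add: c'_def inner_add_left r_def inner_diff_right field_simps)
      \<comment> \<open>\<open>d\<close> agrees on \<open>w\<close> and \<open>a0\<close>, so only
        the positive multiple of \<open>c\<close> counts; \<open>a0\<close> is the point that lets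
        the pivot proceed.\<close>
      have c'a0: "c' \<bullet> a0 > c' \<bullet> w" using r0 a0 max_face_eq[OF dw]
        by (simp add: c'_def inner_add_left)
      have c'const: "c' \<bullet> x = c' \<bullet> w" if "x \<in> closed_segment w a" for x
      proof -
        obtain u where "x = (1 - u) *\<^sub>R w + u *\<^sub>R a" using \<open>x \<in> closed_segment w a\<close> by (auto simp: in_segment)
        then have "c' \<bullet> x = (1 - u) * (c' \<bullet> w) + u * (c' \<bullet> a)" by (simp add: inner_add_right)
        then show ?thesis using c'a by (simp add: algebra_simps)
      qed
      have eS: "closed_segment w a face_of S" using a edge_set_segment by blast
      have a0S: "a0 \<in> S" using a0 edge_set_subset by blast
      obtain G where G: "G face_of S" "closed_segment w a \<subseteq> G" "aff_dim G = aff_dim (closed_segment w a) + 1"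
        "\<And>x. x \<in> G \<Longrightarrow> x \<notin> closed_segment w a \<Longrightarrow> c' \<bullet> x > c' \<bullet> w"
        using pivot[OF S eS _ c'const a0S c'a0] by (metis ends_in_segment(1) empty_iff)
      have wa: "w \<noteq> a" using a by auto
      have dim: "aff_dim G = 2" using G(3) aff_dim_segment[OF wa] by simp
      have GS: "G \<subseteq> S" using G(1) face_of_imp_subset by blast
      \<comment> \<open>Off the edge, \<open>c'\<close> increases while \<open>d\<close> does not,
        and \<open>c' - d\<close> is a positive multiple of \<open>c\<close>. On the edge,
        \<open>c\<close> is interpolated linearly.\<close>
      have up: "c \<bullet> w < c \<bullet> x" if x: "x \<in> G" "x \<noteq> w" for x
      proof (cases "x \<in> closed_segment w a")
        case True
        then obtain u where u: "x = (1 - u) *\<^sub>R w + u *\<^sub>R a" "0 \<le> u" by (auto simp: in_segment)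
        then have "u \<noteq> 0" using x by auto
        then have "u * (c \<bullet> a - c \<bullet> w) > 0" using u a by simp
        moreover have "c \<bullet> x = (1 - u) * (c \<bullet> w) + u * (c \<bullet> a)" using u by (simp add: inner_add_right)
        ultimately show ?thesis by (simp add: algebra_simps)
      next
        case False
        then have "c' \<bullet> x > c' \<bullet> w" using G x by blast
        moreover have "d \<bullet> x \<le> d \<bullet> w" using x GS max_face_le[OF dw(1)] by blast
        ultimately have "r a * (c \<bullet> x) > r a * (c \<bullet> w)" by (simp add: c'_def inner_add_left)
        then show ?thesis using r0 by simp
      qed
      have pG: "polytope G" using G S face_of_polytope_polytope by blast
      have wG: "w extreme_point_of G" using extreme_point_of_face[OF G(1)] aV(2) G(2) ends_in_segment(1) by blast
      have eG: "closed_segment w a \<in> edge_set G" using G a edge_set_face by blast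
      have "\<not> G \<subseteq> closed_segment w a"
        using aff_dim_subset[of G "closed_segment w a"] dim aff_dim_segment[OF wa] by auto
      then obtain x where "x \<in> G" "c' \<bullet> x > c' \<bullet> w" using G(4) by blast
      then obtain b where b: "closed_segment w b \<in> edge_set G" "c' \<bullet> b > c' \<bullet> w"
        using improving_edge[OF pG wG] by blast
      have bG: "b \<in> G" using b edge_set_subset by blast
      have bw: "b \<noteq> w" using b by auto
      have cb: "c \<bullet> w < c \<bullet> b" using up[OF bG bw] .
      \<comment> \<open>Since the edge to \<open>b\<close> improves \<open>c'\<close>, the ratio of
        \<open>b\<close> lies below \<open>r a\<close>, so the rank drops.\<close>
      have "d \<bullet> (w - b) < r a * (c \<bullet> (b - w))"
        using b by (simp add: c'_def inner_add_left inner_diff_right algebra_simps)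
      then have rb: "r b < r a" using cb unfolding r_def[of b]
        by (simp add: inner_diff_right divide_less_eq)
      have bS: "closed_segment w b \<in> edge_set S" using b G edge_set_face by blast
      have "?I a \<subseteq> {v. v extreme_point_of S}" using edge_set_vertices by blast
      then have "finite (?I a)" using finite_vertices[OF S] finite_subset by blast
      moreover have "?I b \<subset> ?I a" using rb bS cb by force
      ultimately have "val b = val a0" using less.hyps[of b] psubset_card_mono bS cb by blast
      then show ?thesis using step[OF G(1) dim eG b(1) up] by simp
    qed simp
  qed
qed

text \<open>Sweep the vertices in decreasing order of a generic functional: the potential of a new vertex
  is forced by any improving edge, and two improving edges in a common polygon force the same
  value because the polygon has its own potential.\<close>
theorem edge_potential_global:
  fixes S :: "'a::euclidean_space set" and l :: "'a set \<Rightarrow> real"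
  assumes S: "polytope S"
    and loc: "\<And>G. G face_of S \<Longrightarrow> aff_dim G = 2 \<Longrightarrow> \<exists>q. edge_potential G l q"
  shows "\<exists>q. edge_potential S l q"
proof -
  define V where "V = {v. v extreme_point_of S}"
  have finV: "finite V" using finite_vertices[OF S] V_def by simp
  obtain c :: 'a where "inj_on ((\<bullet>) c) V" using generic_functional[OF finV] .
  then have inj: "x = y" if "x \<in> V" "y \<in> V" "c \<bullet> x = c \<bullet> y" for x y
    using that by (auto dest: inj_onD)
  let ?pot = "\<lambda>U q. \<forall>p\<in>U. \<forall>p'\<in>U. closed_segment p p' \<in> edge_set S \<longrightarrow>
     q p - q p' = l (closed_segment p p') *\<^sub>R (p - p')"
  \<comment> \<open>The sweep runs through the upper sets \<open>U\<close> of \<open>V\<close> in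
    the order given by \<open>c\<close>; \<open>U = V\<close> is the claim.\<close>
  have "\<exists>q::'a \<Rightarrow> 'a. ?pot U q" if "U \<subseteq> V" "\<And>x y. x \<in> U \<Longrightarrow> y \<in> V \<Longrightarrow> c \<bullet> x < c \<bullet> y \<Longrightarrow> y \<in> U" for U
    using that
  proof (induction "card U" arbitrary: U)
    case 0
    then have "U = {}" using finite_subset[OF _ finV] by auto
    then show ?case by blast
  next
    case (Suc n)
    have finU: "finite U" "U \<noteq> {}" using Suc finV finite_subset by (auto simp: card_gt_0_iff)
    then obtain w where w: "w \<in> U" "\<And>x. x \<in> U \<Longrightarrow> c \<bullet> w \<le> c \<bullet> x"
      using arg_min_if_finite[of U "\<lambda>x. c \<bullet> x"] by (metis not_le)
    define U' where "U' = U - {w}"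
    have wl: "c \<bullet> w < c \<bullet> x" if "x \<in> U'" for x
      using w that inj[of w x] Suc.prems(1) unfolding U'_def by (fastforce simp: less_le)
    have in_U': "x \<in> U'" if "x \<in> V" "c \<bullet> w < c \<bullet> x" for x
      using that w Suc.prems(2)[of w x] by (auto simp: U'_def)
    have "n = card U'" using Suc.hyps(2) w finU by (simp add: U'_def)
    moreover have "U' \<subseteq> V" using Suc.prems U'_def by auto
    moreover have "y \<in> U'" if "x \<in> U'" "y \<in> V" "c \<bullet> x < c \<bullet> y" for x y
      using in_U'[of y] that wl[of x] by simp
    ultimately obtain q :: "'a \<Rightarrow> 'a" where q: "?pot U' q"
      using Suc.hyps(1) by blast
    have wV: "w \<in> V" using w Suc.prems by auto
    show ?case
    proof (cases "\<exists>a0. closed_segment w a0 \<in> edge_set S \<and> c \<bullet> w < c \<bullet> a0")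
      \<comment> \<open>Without an improving edge at \<open>w\<close>, no edge inside
        \<open>U\<close> ends at \<open>w\<close>, and \<open>q\<close> can stay as it is.\<close>
      case False
      have no: False if "p \<in> U" "closed_segment w p \<in> edge_set S" for p
      proof -
        have "p \<noteq> w" using that edge_set_segment by blast
        then show False using that False wl[of p] U'_def by blast
      qed
      have "q p - q p' = l (closed_segment p p') *\<^sub>R (p - p')"
        if pp: "p \<in> U" "p' \<in> U" "closed_segment p p' \<in> edge_set S" for p p'
      proof -
        have "p \<noteq> w" "p' \<noteq> w" using no[of p] no[of p'] pp closed_segment_commute by metis+
        then show ?thesis using pp q U'_def by blast
      qed
      then show ?thesis by blast
    next
      case True
      then obtain a0 where a0: "closed_segment w a0 \<in> edge_set S" "c \<bullet> w < c \<bullet> a0" by blast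
      \<comment> \<open>The value at \<open>w\<close> that the edge from \<open>w\<close> to
        \<open>a\<close> forces, given \<open>q\<close> at \<open>a\<close>.\<close>
      define val where "val a = q a + l (closed_segment w a) *\<^sub>R (w - a)" for a
      have val: "val a = val a0" if a: "closed_segment w a \<in> edge_set S" "c \<bullet> w < c \<bullet> a" for a
      proof (rule improving_edges_connected[OF S a0 a])
        fix G a b assume G: "G face_of S" "aff_dim G = 2"
          and e: "closed_segment w a \<in> edge_set G" "closed_segment w b \<in> edge_set G"
          and up: "\<And>x. x \<in> G \<Longrightarrow> x \<noteq> w \<Longrightarrow> c \<bullet> w < c \<bullet> x"
        obtain qG where qG: "edge_potential G l qG" using loc G by blast
        have pG: "polytope G" using G S face_of_polytope_polytope by blast
        have GV: "x \<in> V" if "x extreme_point_of G" for x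
          using that G extreme_point_of_face V_def by auto
        obtain t where t: "t extreme_point_of G" "t \<in> max_face c G"
          using polytope_max_vertex[OF pG] e edge_set_subset by blast
        \<comment> \<open>An improving path in \<open>G\<close> that starts away from
          \<open>w\<close> never meets \<open>w\<close>, the unique \<open>c\<close>-minimum of
          \<open>G\<close>. It stays in \<open>U'\<close>, where \<open>q\<close> and
          \<open>qG\<close> have the same differences along edges, so \<open>q - qG\<close> keeps
          the value it has at the top vertex \<open>t\<close>.\<close>
        have *: "x \<noteq> w \<longrightarrow> q x - qG x = q t - qG t" if "x extreme_point_of G" for x
          using pG that
        proof (induction rule: improving_edge_induct[where c = c])
          case (max x)
          then have "x = t" using inj GV t max_face_eq by metis
          then show ?case by simp
        next
          case (step x y)
          show ?case
          proof
            assume "x \<noteq> w"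
            have V: "x \<in> V" "y \<in> V" "x \<in> G" "y \<in> G"
              using step(1) edge_set_vertices edge_set_subset GV by blast+
            then have cx: "c \<bullet> w < c \<bullet> x" using up \<open>x \<noteq> w\<close> by blast
            then have cy: "c \<bullet> w < c \<bullet> y" using step by simp
            then have "y \<noteq> w" by auto
            moreover have "q x - q y = l (closed_segment x y) *\<^sub>R (x - y)"
              using q in_U' V cx cy step(1) edge_set_face[OF G(1)] by blast
            moreover have "qG x - qG y = l (closed_segment x y) *\<^sub>R (x - y)"
              using edge_potentialD[OF qG step(1)] .
            ultimately have "q x - q y = qG x - qG y" by simp
            then have "q x - qG x = q y - qG y" by (simp add: algebra_simps)
            then show "q x - qG x = q t - qG t" using step(3) \<open>y \<noteq> w\<close> by simp
          qed
        qed
        have "a \<noteq> w" "b \<noteq> w" using e edge_set_segment by auto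
        then have "q a - qG a = q t - qG t" "q b - qG b = q t - qG t"
          using * e edge_set_vertices(2) by blast+
        moreover have "val a = (q a - qG a) + qG w"
          by (simp add: val_def edge_potentialD[OF qG e(1), symmetric])
        moreover have "val b = (q b - qG b) + qG w"
          by (simp add: val_def edge_potentialD[OF qG e(2), symmetric])
        ultimately show "val a = val b" by simp
      qed
      define q' where "q' = q(w := val a0)"
      have new: "q' w - q' p = l (closed_segment w p) *\<^sub>R (w - p)"
        if "p \<in> U" "closed_segment w p \<in> edge_set S" for p
      proof -
        have "p \<noteq> w" using that edge_set_segment by auto
        then have "p \<in> U'" using that U'_def by simp
        then have "val p = val a0" using val[of p] wl[of p] that by blast
        then show ?thesis using \<open>p \<noteq> w\<close> by (simp add: q'_def val_def algebra_simps)
      qed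
      have "q' p - q' p' = l (closed_segment p p') *\<^sub>R (p - p')"
        if pp: "p \<in> U" "p' \<in> U" "closed_segment p p' \<in> edge_set S" for p p'
      proof -
        consider "p = w" | "p' = w" | "p \<in> U'" "p' \<in> U'" using pp U'_def by blast
        then show ?thesis
        proof cases
          case 1 then show ?thesis using new pp by blast
        next
          case 2
          then have "q' w - q' p = l (closed_segment w p) *\<^sub>R (w - p)"
            using new[of p] pp by (simp add: closed_segment_commute)
          then have "q' p - q' w = - (l (closed_segment w p) *\<^sub>R (w - p))" by (metis minus_diff_eq)
          also have "\<dots> = l (closed_segment p w) *\<^sub>R (p - w)"
            by (simp add: closed_segment_commute algebra_simps)
          finally show ?thesis using 2 by simp
        next
          case 3
          then have "p \<noteq> w" "p' \<noteq> w" using U'_def by auto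
          then show ?thesis using q pp 3 by (simp add: q'_def)
        qed
      qed
      then show ?thesis by blast
    qed
  qed
  from this[of V] obtain q where "?pot V q" by auto
  then have "edge_potential S l q" unfolding edge_potential_def
    using edge_set_vertices V_def by blast
  then show ?thesis by blast
qed

section \<open>From nonnegative potentials to weak Minkowski summands\<close>

text \<open>Along an edge that improves \<open>c\<close>, a nonnegative length makes
  \<open>q\<close> move in the same direction, so \<open>c\<close> cannot decrease on the images
  along an improving path.\<close>

lemma edge_potential_max:
  fixes S :: "'a::euclidean_space set"
  assumes S: "polytope S" and q: "edge_potential S l q"
    and l: "\<And>e. e \<in> edge_set S \<Longrightarrow> 0 \<le> l e"
    and u: "u extreme_point_of S" "u \<in> max_face c S" and v: "v extreme_point_of S"
  shows "c \<bullet> q v \<le> c \<bullet> q u"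
proof -
  \<comment> \<open>\<open>c\<close> may have several maximizers; perturbing it towards \<open>d\<close> makes every improving path end in \<open>u\<close>.\<close>
  obtain d where d: "\<And>x. x \<in> S \<Longrightarrow> x \<noteq> u \<Longrightarrow> d \<bullet> x < d \<bullet> u"
    using vertex_exposing[OF S u(1)] by blast
  have uS: "u \<in> S" using u by (simp add: extreme_point_of_def)
  have pert: "(c + \<epsilon> *\<^sub>R d) \<bullet> q v \<le> (c + \<epsilon> *\<^sub>R d) \<bullet> q u" if "\<epsilon> > 0" for \<epsilon>
    using S v
  proof (induction rule: improving_edge_induct[where c = "c + \<epsilon> *\<^sub>R d"])
    case (max x)
    have "x = u"
    proof (rule ccontr)
      assume "x \<noteq> u"
      then have "\<epsilon> * (d \<bullet> x) < \<epsilon> * (d \<bullet> u)" "c \<bullet> x \<le> c \<bullet> u"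
        using max d u \<open>\<epsilon> > 0\<close> max_face_le by (auto simp: extreme_point_of_def)
      then show False using max_face_le[OF max(2) uS] by (simp add: inner_add_left)
    qed
    then show ?case by simp
  next
    case (step x a)
    have "(c + \<epsilon> *\<^sub>R d) \<bullet> (q x - q a) = l (closed_segment x a) * ((c + \<epsilon> *\<^sub>R d) \<bullet> (x - a))"
      using edge_potentialD[OF q step(1)] by simp
    also have "\<dots> \<le> 0" using l[OF step(1)] step(2) by (simp add: mult_nonneg_nonpos inner_diff_right)
    finally show ?case using step(3) by (simp add: inner_diff_right)
  qed
  show ?thesis
  proof (rule field_le_epsilon)
    fix \<epsilon> :: real assume \<epsilon>: "\<epsilon> > 0"
    define D where "D = d \<bullet> (q u - q v)"
    \<comment> \<open>Chosen so that the perturbation contributes at most \<open>\<epsilon>\<close>;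
      the added 1 keeps the denominator positive when \<open>D = 0\<close>.\<close>
    define \<eta> where "\<eta> = \<epsilon> / (\<bar>D\<bar> + 1)"
    have "\<eta> > 0" "\<eta> * (\<bar>D\<bar> + 1) = \<epsilon>" using \<epsilon> by (auto simp: \<eta>_def)
    moreover have "c \<bullet> q v \<le> c \<bullet> q u + \<eta> * D"
      using pert[OF \<open>\<eta> > 0\<close>] by (simp add: inner_add_left D_def inner_diff_right algebra_simps)
    moreover have "\<eta> * D \<le> \<eta> * (\<bar>D\<bar> + 1)" using \<open>\<eta> > 0\<close> by simp
    ultimately show "c \<bullet> q v \<le> c \<bullet> q u + \<epsilon>" by linarith
  qed
qed

text \<open>The maximality clause is \<open>edge_potential_max\<close>. For extremality, edges of
  length zero may give other vertices the same image as \<open>u\<close>; a functional exposing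
  \<open>u\<close> puts all remaining images strictly below \<open>q u\<close>.\<close>

lemma edge_potential_associated_vertex:
  fixes S :: "'a::euclidean_space set"
  assumes S: "polytope S" and q: "edge_potential S l q"
    and l: "\<And>e. e \<in> edge_set S \<Longrightarrow> 0 \<le> l e"
    and u: "u extreme_point_of S"
  shows "associated_vertex S (convex hull (q ` {v. v extreme_point_of S})) u (q u)"
proof -
  let ?V = "{v. v extreme_point_of S}"
  let ?R = "convex hull (q ` ?V)"
  obtain d where d: "\<And>x. x \<in> S \<Longrightarrow> x \<noteq> u \<Longrightarrow> d \<bullet> x < d \<bullet> u"
    using vertex_exposing[OF S u] by blast
  have uS: "u \<in> S" using u by (simp add: extreme_point_of_def)
  have strict: "q x = q u \<or> d \<bullet> q x < d \<bullet> q u" if "x extreme_point_of S" for x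
    using S that
  proof (induction rule: improving_edge_induct[where c = d])
    case (max x)
    then have "x = u" using d uS max_face_le[OF max(2) uS] by (fastforce simp: extreme_point_of_def)
    then show ?case by simp
  next
    case (step x a)
    have eq: "q x - q a = l (closed_segment x a) *\<^sub>R (x - a)"
      using edge_potentialD[OF q step(1)] .
    show ?case
    proof (cases "l (closed_segment x a) = 0")
      case True
      then show ?thesis using eq step(3) by simp
    next
      case False
      then have "l (closed_segment x a) > 0" using l[OF step(1)] by simp
      then have "l (closed_segment x a) * (d \<bullet> (x - a)) < 0"
        using step(2) by (intro mult_pos_neg) (auto simp: inner_diff_right)
      moreover have "d \<bullet> (q x - q a) = l (closed_segment x a) * (d \<bullet> (x - a))" using eq by simp
      ultimately show ?thesis using step(3) by (auto simp: inner_diff_right)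
    qed
  qed
  have "q u extreme_point_of ?R"
  proof -
    have "q u \<notin> convex hull (q ` ?V - {q u})"
    proof -
      have "q ` ?V - {q u} \<subseteq> {x. d \<bullet> x < d \<bullet> q u}" using strict by auto
      then have "convex hull (q ` ?V - {q u}) \<subseteq> {x. d \<bullet> x < d \<bullet> q u}"
        by (simp add: hull_minimal convex_halfspace_lt)
      then show ?thesis by blast
    qed
    moreover have "q ` ?V = insert (q u) (q ` ?V - {q u})" using u by blast
    ultimately show ?thesis
      using extreme_point_of_convex_hull_insert[of "q ` ?V - {q u}" "q u"] finite_vertices[OF S]
      by (metis finite_Diff finite_imageI)
  qed
  moreover have "c \<bullet> y \<le> c \<bullet> q u" if "\<forall>x\<in>S. c \<bullet> x \<le> c \<bullet> u" "y \<in> ?R" for c y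
  proof -
    have "u \<in> max_face c S" using uS that by (simp add: max_face_def)
    then have "q ` ?V \<subseteq> {x. c \<bullet> x \<le> c \<bullet> q u}" using edge_potential_max[OF S q l u] by blast
    then have "?R \<subseteq> {x. c \<bullet> x \<le> c \<bullet> q u}" by (simp add: hull_minimal convex_halfspace_le)
    then show ?thesis using that by blast
  qed
  ultimately show ?thesis by (auto simp: associated_vertex_def)
qed

text \<open>The complementary summand arises from the same construction: the lengths
  \<open>k - l e\<close> are again nonnegative and have the potential
  \<open>k *\<^sub>R v - q v\<close>. The two potentials add up to the dilation by
  \<open>k\<close>.\<close>

lemma edge_potential_deformation:
  fixes S :: "'a::euclidean_space set"
  assumes S: "polytope S" "S \<noteq> {}" and q: "edge_potential S l q"
    and l: "\<And>e. e \<in> edge_set S \<Longrightarrow> 0 \<le> l e"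
  shows "deformation_of (convex hull (q ` {v. v extreme_point_of S})) S"
proof -
  let ?V = "{v. v extreme_point_of S}"
  let ?R = "convex hull (q ` ?V)"
  have finE: "finite (edge_set S)" by (rule finite_edge_set[OF S(1)])
  \<comment> \<open>Nonnegativity lets the sum bound each single length; the 1 keeps
    \<open>k\<close> positive even if all lengths vanish.\<close>
  define k where "k = 1 + sum l (edge_set S)"
  have lk: "l e \<le> k" if "e \<in> edge_set S" for e
    using member_le_sum[of e "edge_set S" l] that l finE k_def by auto
  have "k > 0" using sum_nonneg[of "edge_set S" l] l k_def by auto
  define q' where "q' v = k *\<^sub>R v - q v" for v
  let ?R' = "convex hull (q' ` ?V)"
  have q': "edge_potential S (\<lambda>e. k - l e) q'"
    unfolding edge_potential_def
  proof (intro allI impI)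
    fix p p' assume "closed_segment p p' \<in> edge_set S"
    note edge_potentialD[OF q this]
    moreover have "q' p - q' p' = k *\<^sub>R (p - p') - (q p - q p')"
      by (simp add: q'_def algebra_simps)
    ultimately show "q' p - q' p' = (k - l (closed_segment p p')) *\<^sub>R (p - p')"
      by (simp add: scaleR_diff_left)
  qed
  have l': "0 \<le> k - l e" if "e \<in> edge_set S" for e using lk[OF that] by simp
  let ?kS = "(\<lambda>x. k *\<^sub>R x) ` S"
  have "polytope ?R" "polytope ?R'" "polytope ?kS"
    using finite_vertices[OF S(1)] S(1) by (auto intro!: polytope_convex_hull polytope_scaling)
  have "?kS = ?R + ?R'"
  proof
    have "?kS = convex hull ((\<lambda>x. k *\<^sub>R x) ` ?V)"
      using convex_hull_scaling[of k ?V] convex_hull_vertices[OF S(1)] by simp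
    also have "\<dots> \<subseteq> convex hull (q ` ?V + q' ` ?V)"
    proof (intro hull_mono subsetI)
      fix z assume "z \<in> (\<lambda>x. k *\<^sub>R x) ` ?V"
      then obtain v where v: "v \<in> ?V" "z = k *\<^sub>R v" by blast
      then have "z = q v + q' v" by (simp add: q'_def)
      then show "z \<in> q ` ?V + q' ` ?V" using v(1) by blast
    qed
    finally show "?kS \<subseteq> ?R + ?R'" by (simp add: convex_hull_set_plus)
    have "q ` ?V + q' ` ?V \<subseteq> ?kS"
    proof
      fix z assume "z \<in> q ` ?V + q' ` ?V"
      then obtain u v where uv: "u extreme_point_of S" "v extreme_point_of S" "z = q u + q' v"
        by (auto elim!: set_plus_elim)
      \<comment> \<open>A separating functional would be minimal over \<open>S\<close> at some
        vertex \<open>t\<close>. Both potentials respect this, so \<open>z\<close> cannot lie beyond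
        \<open>q t + q' t = k *\<^sub>R t\<close>, a point of the dilate.\<close>
      show "z \<in> ?kS"
      proof (rule ccontr)
        assume "z \<notin> ?kS"
        then obtain a b where ab: "a \<bullet> z < b" "\<forall>x\<in>?kS. b < a \<bullet> x"
          using separating_hyperplane_closed_point[of ?kS z] \<open>polytope ?kS\<close>
            polytope_imp_closed polytope_imp_convex by metis
        obtain t where t: "t extreme_point_of S" "t \<in> max_face (- a) S"
          using polytope_max_vertex[OF S] by blast
        have "- a \<bullet> q u \<le> - a \<bullet> q t"
          by (rule edge_potential_max[OF S(1) q l t uv(1)])
        moreover have "- a \<bullet> q' v \<le> - a \<bullet> q' t"
          by (rule edge_potential_max[OF S(1) q' l' t uv(2)])
        ultimately have "a \<bullet> (k *\<^sub>R t) \<le> a \<bullet> z"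
          by (simp add: uv q'_def inner_add_right inner_diff_right)
        moreover have "k *\<^sub>R t \<in> ?kS" using t(1) by (intro imageI) (simp add: extreme_point_of_def)
        ultimately show False using ab by fastforce
      qed
    qed
    then have "convex hull (q ` ?V + q' ` ?V) \<subseteq> ?kS"
      using \<open>polytope ?kS\<close> by (simp add: hull_minimal polytope_imp_convex)
    then show "?R + ?R' \<subseteq> ?kS" by (simp add: convex_hull_set_plus)
  qed
  then show ?thesis
    using \<open>polytope ?R\<close> \<open>polytope ?R'\<close> \<open>k > 0\<close> by (auto simp: deformation_of_def)
qed

text \<open>The vertex map in an edge-deformation vector already is a potential; conversely the hull
  of the potential values serves as \<open>R\<close>. The summand disappears, and only linear
  conditions on \<open>l\<close> remain for the later arguments.\<close>

theorem deformation_cone_iff: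
  fixes S :: "'a::euclidean_space set"
  assumes S: "polytope S" "S \<noteq> {}"
  shows "l \<in> deformation_cone S \<longleftrightarrow>
     Poly_Mapping.keys l \<subseteq> edge_set S \<and> (\<forall>e\<in>edge_set S. 0 \<le> Poly_Mapping.lookup l e) \<and>
     (\<exists>q. edge_potential S (Poly_Mapping.lookup l) q)" (is "?lhs \<longleftrightarrow> ?rhs")
proof
  assume ?lhs
  then obtain R q where R: "Poly_Mapping.keys l \<subseteq> edge_set S"
    and q: "\<And>p p'. closed_segment p p' \<in> edge_set S \<Longrightarrow> 0 \<le> Poly_Mapping.lookup l (closed_segment p p') \<and>
             q p - q p' = Poly_Mapping.lookup l (closed_segment p p') *\<^sub>R (p - p')"
    unfolding deformation_cone_def edge_deformation_vector_def by blast
  have "0 \<le> Poly_Mapping.lookup l e" if "e \<in> edge_set S" for e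
    using edge_setE[OF S(1) that] q that by metis
  then show ?rhs using R q unfolding edge_potential_def by blast
next
  assume r: ?rhs
  then obtain q where q: "edge_potential S (Poly_Mapping.lookup l) q" by blast
  let ?R = "convex hull (q ` {v. v extreme_point_of S})"
  have "deformation_of ?R S"
    using edge_potential_deformation[OF S q] r by blast
  moreover have "edge_deformation_vector S ?R l"
    unfolding edge_deformation_vector_def
    using r edge_potential_associated_vertex[OF S(1) q] q unfolding edge_potential_def by blast
  ultimately show ?lhs by (auto simp: deformation_cone_def)
qed

section \<open>Faces of Minkowski sums\<close>

text \<open>The component of \<open>u\<close> orthogonal to \<open>span L\<close> is such an
  \<open>m\<close>. It serves to cut a face along \<open>u\<close> while leaving all directions in
  \<open>span L\<close> intact.\<close>

lemma orthogonal_functional: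
  fixes u :: "'a::euclidean_space"
  assumes "u \<notin> span L"
  obtains m where "\<And>x. x \<in> span L \<Longrightarrow> m \<bullet> x = 0" "m \<bullet> u > 0"
proof -
  obtain y z where yz: "y \<in> span L" "\<And>w. w \<in> span L \<Longrightarrow> orthogonal z w" "u = y + z"
    using orthogonal_subspace_decomp_exists[of L u] by blast
  have "z \<noteq> 0" using yz assms by auto
  then have "z \<bullet> u > 0" using yz by (simp add: inner_add_right orthogonal_def)
  then show ?thesis using that[of z] yz by (simp add: orthogonal_def)
qed

lemma plane_span:
  fixes H :: "'a::euclidean_space set"
  assumes "aff_dim H = 2" "w \<in> H" "a \<in> H" "b \<in> H" "independent {a - w, b - w}" "a \<noteq> b"
    and "x \<in> H" "y \<in> H"
  shows "y - x \<in> span {a - w, b - w}"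
proof -
  have "aff_dim H = int (dim ((+) (- w) ` H))"
    using assms by (intro aff_dim_eq_dim) (simp add: hull_inc)
  then have "dim ((+) (- w) ` H) = 2" using assms by simp
  moreover have "card {a - w, b - w} = 2" using assms(6) by simp
  moreover have "{a - w, b - w} \<subseteq> (+) (- w) ` H" using assms(3,4) by (auto simp: image_iff)
  ultimately have *: "(+) (- w) ` H \<subseteq> span {a - w, b - w}"
    using card_ge_dim_independent[of "{a - w, b - w}" "(+) (- w) ` H"] assms(5) by simp
  have "z - w \<in> span {a - w, b - w}" if "z \<in> H" for z
  proof -
    have "- w + z \<in> (+) (- w) ` H" using that by blast
    then show ?thesis using * by auto
  qed
  from span_diff[OF this[OF assms(8)] this[OF assms(7)]] show ?thesis by simp
qed

text \<open>The second edge at \<open>w\<close> is chosen to improve a functional vanishing on the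
  first edge direction, which makes the two directions independent.\<close>

lemma polygon_edges:
  fixes G :: "'a::euclidean_space set"
  assumes G: "polytope G" "aff_dim G = 2"
  obtains w a b where "closed_segment w a \<in> edge_set G" "closed_segment w b \<in> edge_set G"
    "independent {a - w, b - w}" "a \<noteq> b"
proof -
  have "G \<noteq> {}" using G by auto
  then obtain w where w: "w extreme_point_of G" using polytope_max_vertex[OF G(1)] by blast
  then have wG: "w \<in> G" by (simp add: extreme_point_of_def)
  have "G \<noteq> {w}" using G by auto
  then obtain x where "x \<in> G" "x \<noteq> w" using wG by blast
  then obtain a where a: "closed_segment w a \<in> edge_set G" using edge_at_vertex[OF G(1) w] by blast
  then have aw: "a - w \<noteq> 0" using edge_set_segment by auto
  have "\<exists>y\<in>G. y - w \<notin> span {a - w}"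
  proof (rule ccontr)
    assume "\<not> ?thesis"
    then have "(+) (- w) ` G \<subseteq> span {a - w}" by auto
    then have "dim ((+) (- w) ` G) \<le> card {a - w}"
      by (metis dim_le_card finite.emptyI finite_insert)
    moreover have "aff_dim G = int (dim ((+) (- w) ` G))"
      using wG by (intro aff_dim_eq_dim) (simp add: hull_inc)
    ultimately show False using G(2) by simp
  qed
  then obtain y where y: "y \<in> G" "y - w \<notin> span {a - w}" by blast
  obtain m where m: "\<And>x. x \<in> span {a - w} \<Longrightarrow> m \<bullet> x = 0" "m \<bullet> (y - w) > 0"
    using orthogonal_functional[OF y(2)] by blast
  then obtain b where b: "closed_segment w b \<in> edge_set G" "m \<bullet> b > m \<bullet> w"
    using improving_edge[OF G(1) w y(1)] by (auto simp: inner_diff_right)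
  have nb: "b - w \<notin> span {a - w}" using b m(1)[of "b - w"] by (auto simp: inner_diff_right)
  then have "independent {b - w, a - w}" using aw by (simp add: independent_insert)
  moreover have "a \<noteq> b" using nb by (auto simp: span_base)
  ultimately show ?thesis using that[OF a b(1)] by (simp add: insert_commute)
qed

lemma span_pair:
  assumes "x \<in> span {u, v}"
  obtains \<alpha> \<beta> where "x = \<alpha> *\<^sub>R u + \<beta> *\<^sub>R v"
proof -
  obtain \<alpha> where "x - \<alpha> *\<^sub>R u \<in> span {v}" using assms by (auto simp: span_insert)
  then obtain \<beta> where "x - \<alpha> *\<^sub>R u = \<beta> *\<^sub>R v" by (auto simp: span_singleton)
  then show ?thesis using that[of \<alpha> \<beta>] by (simp add: algebra_simps)
qed

text \<open>2-genericity is phrased with pairs of edges, while its uses need the direction plane.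
  Two independent edges of \<open>F\<close> at one vertex span that plane, and it is also the
  direction plane of any two-dimensional set containing a translate of \<open>F\<close>.\<close>

lemma two_face_span:
  fixes P :: "'a::euclidean_space set"
  assumes P: "polytope P" and F: "F face_of P" "aff_dim F = 2"
  obtains L where
    "\<And>H v x y. F + {v} \<subseteq> H \<Longrightarrow> aff_dim H = 2 \<Longrightarrow> x \<in> H \<Longrightarrow> y \<in> H \<Longrightarrow> y - x \<in> span L"
    "\<And>\<delta>. two_generic P \<delta> \<Longrightarrow> \<delta> \<notin> span L"
proof -
  have "polytope F" using P F face_of_polytope_polytope by blast
  then obtain w a b where e: "closed_segment w a \<in> edge_set F" "closed_segment w b \<in> edge_set F"
    and ind: "independent {a - w, b - w}" "a \<noteq> b"
    using polygon_edges[OF _ F(2)] by blast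
  show ?thesis
  proof (rule that[of "{a - w, b - w}"])
    fix H v x y assume H: "F + {v} \<subseteq> H" "aff_dim H = 2" "x \<in> H" "y \<in> H"
    have "w + v \<in> H" "a + v \<in> H" "b + v \<in> H" using H(1) e edge_set_subset by blast+
    then show "y - x \<in> span {a - w, b - w}"
      using plane_span[of H "w + v" "a + v" "b + v" x y] H ind by simp
  next
    fix \<delta> assume t: "two_generic P \<delta>"
    show "\<delta> \<notin> span {a - w, b - w}"
    proof
      assume "\<delta> \<in> span {a - w, b - w}"
      then obtain \<alpha> \<beta> where "\<delta> = \<alpha> *\<^sub>R (a - w) + \<beta> *\<^sub>R (b - w)" by (rule span_pair)
      then show False using t e F unfolding two_generic_def edge_set_face[OF F(1)] by blast
    qed
  qed
qed

lemma polytope_plus: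
  fixes P Q :: "'a::euclidean_space set"
  assumes "polytope P" "polytope Q"
  shows "polytope (P + Q)"
proof -
  obtain u v where "finite u" "P = convex hull u" "finite v" "Q = convex hull v"
    using assms by (auto simp: polytope_def)
  then have "P + Q = convex hull (u + v)" "finite (u + v)"
    by (auto simp: convex_hull_set_plus finite_set_plus)
  then show ?thesis by (auto simp: polytope_def)
qed

text \<open>\<open>A\<close> and \<open>B\<close> are the faces of the summands exposed by a
  functional that exposes \<open>G\<close>. The last property says that every decomposition of a
  point of \<open>G\<close> uses them, so \<open>G\<close> determines them.\<close>

lemma face_of_plusE:
  fixes P Q :: "'a::euclidean_space set"
  assumes "polytope P" "P \<noteq> {}" "polytope Q" "Q \<noteq> {}" "G face_of P + Q" "G \<noteq> {}"
  obtains A B where "G = A + B" "A face_of P" "A \<noteq> {}" "B face_of Q" "B \<noteq> {}"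
    "\<And>x y. x \<in> P \<Longrightarrow> y \<in> Q \<Longrightarrow> x + y \<in> G \<Longrightarrow> x \<in> A \<and> y \<in> B"
proof -
  obtain c where c: "G = max_face c (P + Q)"
    using face_is_max_face[OF polytope_plus assms(5,6)] assms(1,3) by blast
  show ?thesis
  proof (rule that[of "max_face c P" "max_face c Q"])
    show "G = max_face c P + max_face c Q" using c max_face_plus assms by blast
    show "max_face c P face_of P" "max_face c Q face_of Q"
      using assms by (simp_all add: max_face_face_of polytope_imp_convex)
    show "max_face c P \<noteq> {}" "max_face c Q \<noteq> {}" using assms max_face_nonempty by blast+
    show "x \<in> max_face c P \<and> y \<in> max_face c Q" if "x \<in> P" "y \<in> Q" "x + y \<in> G" for x y
      using max_face_plusD that c by blast
  qed
qed

lemma plus_singleton_iff: "x \<in> A + {v} \<longleftrightarrow> x - v \<in> A" for v :: "'a::ab_group_add"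
proof
  assume "x - v \<in> A"
  then have "x - v + v \<in> A + {v}" by blast
  then show "x \<in> A + {v}" by simp
qed (auto elim!: set_plus_elim)

lemma plus_singleton_image: "A + {v} = (+) v ` A" for v :: "'a::ab_group_add"
  by (force simp: set_plus_def add.commute)

lemma aff_dim_plus_singleton: "aff_dim (A + {v}) = aff_dim A" for v :: "'a::euclidean_space"
  by (simp add: plus_singleton_image aff_dim_translation_eq)

lemma closed_segment_plus_singleton:
  "closed_segment a b + {v} = closed_segment (a + v) (b + v)" for v :: "'a::euclidean_space"
  unfolding plus_singleton_image closed_segment_translation[symmetric] by (simp only: add.commute)

text \<open>Decomposing the points of \<open>e + {v}\<close> in the obvious way puts
  \<open>e\<close> into \<open>A\<close> and \<open>v\<close> into \<open>B\<close>; then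
  \<open>A + {v}\<close> lies in \<open>e + {v}\<close>, which gives the reverse inclusion.\<close>

lemma plus_singleton_face:
  fixes e A :: "'a::euclidean_space set"
  assumes "polytope P" "P \<noteq> {}" "polytope Q" "Q \<noteq> {}" "e + {v} face_of P + Q" "e \<noteq> {}" "e \<subseteq> P" "v \<in> Q"
    and "e + {v} = A + B" "\<And>x y. x \<in> P \<Longrightarrow> y \<in> Q \<Longrightarrow> x + y \<in> e + {v} \<Longrightarrow> x \<in> A \<and> y \<in> B"
  shows "e = A" and "v \<in> B"
proof -
  obtain x where "x \<in> e" using assms by auto
  then show vB: "v \<in> B" using assms by blast
  show "e = A"
  proof
    show "e \<subseteq> A" using assms by blast
    show "A \<subseteq> e"
    proof
      fix x assume "x \<in> A"
      then have "x + v \<in> e + {v}" using vB assms(9) by blast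
      then show "x \<in> e" by (simp add: plus_singleton_iff)
    qed
  qed
qed

text \<open>A maximizer of \<open>\<delta> \<bullet> x\<close> on \<open>e\<close> cannot be moved
  further along \<open>\<delta>\<close>.\<close>

lemma translate_subset_bounded:
  fixes e :: "'a::euclidean_space set"
  assumes "compact e" "e \<noteq> {}" "\<And>x. x \<in> e \<Longrightarrow> x + \<delta> \<in> e"
  shows "\<delta> = 0"
proof -
  have "continuous_on e (\<lambda>x. \<delta> \<bullet> x)" by (intro continuous_intros)
  then obtain x where x: "x \<in> e" "\<And>y. y \<in> e \<Longrightarrow> \<delta> \<bullet> y \<le> \<delta> \<bullet> x"
    using continuous_attains_sup[of e "\<lambda>x. \<delta> \<bullet> x"] assms by blast
  then have "\<delta> \<bullet> (x + \<delta>) \<le> \<delta> \<bullet> x" using assms by blast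
  then have "\<delta> \<bullet> \<delta> \<le> 0" by (simp add: inner_add_right)
  then show ?thesis using inner_gt_zero_iff[of \<delta>] by linarith
qed

text \<open>Among the faces \<open>K\<close> of \<open>Q\<close> for which \<open>F + K\<close> is a
  face of the sum, take a minimal one. If it had an edge, a functional vanishing on the directions
  of \<open>F\<close> but not on that edge would keep \<open>F\<close> whole and replace
  \<open>K\<close> by a smaller face. Hence \<open>K\<close> is a vertex.\<close>

lemma exists_vertex_translate:
  fixes P Q :: "'a::euclidean_space set"
  assumes P: "polytope P" "P \<noteq> {}" and Q: "polytope Q" "Q \<noteq> {}" and F: "F face_of P" "F \<noteq> {}"
    and L: "\<And>x y. x \<in> F \<Longrightarrow> y \<in> F \<Longrightarrow> y - x \<in> span L"
    and nL: "\<And>a b. closed_segment a b \<in> edge_set Q \<Longrightarrow> b - a \<notin> span L"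
  obtains v where "v extreme_point_of Q" "F + {v} face_of P + Q"
proof -
  let ?K = "{K. K face_of Q \<and> K \<noteq> {} \<and> F + K face_of P + Q}"
  obtain c where c: "F = max_face c P" using face_is_max_face[OF P(1) F] by blast
  have "max_face c (P + Q) face_of P + Q"
    using polytope_plus[OF P(1) Q(1)] polytope_imp_convex max_face_face_of by blast
  then have "F + max_face c Q face_of P + Q" using c max_face_plus[OF P(2) Q(2)] by simp
  moreover have "max_face c Q face_of Q" using Q polytope_imp_convex max_face_face_of by blast
  ultimately have "max_face c Q \<in> ?K" using max_face_nonempty[OF Q] by simp
  moreover have "finite ?K" by (rule finite_subset[OF _ finite_polytope_faces[OF Q(1)]]) auto
  ultimately obtain K where "K \<in> ?K" "\<forall>H\<in>?K. H \<subseteq> K \<longrightarrow> K = H"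
    using finite_has_minimal[of ?K] by blast
  then have K: "K face_of Q" "K \<noteq> {}" "F + K face_of P + Q"
    and min: "\<And>H. H \<in> ?K \<Longrightarrow> H \<subseteq> K \<Longrightarrow> K = H" by blast+
  have pK: "polytope K" using K Q face_of_polytope_polytope by blast
  obtain v where v: "v extreme_point_of K" using polytope_max_vertex[OF pK K(2)] by blast
  have vK: "v \<in> K" using v by (simp add: extreme_point_of_def)
  have "K = {v}"
  proof (rule ccontr)
    assume "K \<noteq> {v}"
    then obtain x where "x \<in> K" "x \<noteq> v" using vK by blast
    then obtain a where a: "closed_segment v a \<in> edge_set K" using edge_at_vertex[OF pK v] by blast
    then have "closed_segment v a \<in> edge_set Q" using edge_set_face[OF K(1)] by blast
    then obtain m where m: "\<And>x. x \<in> span L \<Longrightarrow> m \<bullet> x = 0" "m \<bullet> (a - v) > 0"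
      using orthogonal_functional[OF nL] by blast
    have "m \<bullet> x = m \<bullet> y" if "x \<in> F" "y \<in> F" for x y
      using m(1)[OF L[OF that]] by (simp add: inner_diff_right)
    then have "max_face m F = F" by (rule max_face_const)
    then have "max_face m (F + K) = F + max_face m K"
      using max_face_plus[OF F(2) K(2), of m] by simp
    moreover have "max_face m (F + K) face_of P + Q"
      using face_of_trans[OF max_face_face_of K(3)] K(3) face_of_imp_convex by blast
    moreover have "max_face m K face_of Q"
      using face_of_trans[OF max_face_face_of K(1)] K(1) face_of_imp_convex by blast
    moreover have "max_face m K \<noteq> {}" by (rule max_face_nonempty[OF pK K(2)])
    ultimately have "max_face m K \<in> ?K" by simp
    then have "K = max_face m K" using min max_face_subset by blast
    then have "m \<bullet> a \<le> m \<bullet> v" using max_face_le[of v m K a] vK a edge_set_subset by metis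
    then show False using m(2) by (simp add: inner_diff_right)
  qed
  then show ?thesis using that[of v] K by (simp add: face_of_singleton)
qed

section \<open>Polytopes in parallelogramic position\<close>

lemma segment_diff_span:
  fixes a b :: "'a::euclidean_space"
  assumes "x \<in> closed_segment a b" "y \<in> closed_segment a b"
  shows "y - x \<in> span {b - a}"
proof -
  obtain s t where st: "x = a + s *\<^sub>R (b - a)" "y = a + t *\<^sub>R (b - a)"
    using assms by (auto simp: in_segment algebra_simps)
  have "y - x = (t - s) *\<^sub>R (b - a)" unfolding st by (simp add: algebra_simps)
  then show ?thesis by (auto simp: span_singleton)
qed

text \<open>A functional orthogonal to \<open>b - a\<close> and positive on \<open>v - v'\<close> is
  constant on the first segment and maximal only at \<open>v\<close> on the second.\<close>

lemma segment_face_of_parallelogram: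
  fixes a b v v' :: "'a::euclidean_space"
  assumes "v - v' \<notin> span {b - a}"
  shows "closed_segment a b + {v} face_of closed_segment a b + closed_segment v v'"
proof -
  obtain m where m: "\<And>x. x \<in> span {b - a} \<Longrightarrow> m \<bullet> x = 0" "m \<bullet> (v - v') > 0"
    using orthogonal_functional[OF assms] by blast
  have "m \<bullet> x = m \<bullet> y" if "x \<in> closed_segment a b" "y \<in> closed_segment a b" for x y
    using m(1)[OF segment_diff_span[OF that]] by (simp add: inner_diff_right)
  then have 1: "max_face m (closed_segment a b) = closed_segment a b" by (rule max_face_const)
  have le: "m \<bullet> z \<le> m \<bullet> v \<and> (z \<noteq> v \<longrightarrow> m \<bullet> z < m \<bullet> v)" if "z \<in> closed_segment v v'" for z
  proof -
    obtain u where u: "z = (1 - u) *\<^sub>R v + u *\<^sub>R v'" "0 \<le> u" using \<open>z \<in> closed_segment v v'\<close> by (auto simp: in_segment)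
    have eq: "m \<bullet> v - m \<bullet> z = u * (m \<bullet> (v - v'))"
      unfolding u(1) by (simp add: inner_add_right inner_diff_right algebra_simps)
    show ?thesis
    proof (cases "u = 0")
      case True then show ?thesis using u by simp
    next
      case False
      then have "u * (m \<bullet> (v - v')) > 0" using u m by simp
      then show ?thesis using eq by linarith
    qed
  qed
  have "max_face m (closed_segment v v') = {v}"
  proof
    show "max_face m (closed_segment v v') \<subseteq> {v}"
      using le max_face_le max_face_subset by (metis ends_in_segment(1) not_le singletonI subsetD subsetI)
    show "{v} \<subseteq> max_face m (closed_segment v v')" using le by (auto intro: max_faceI)
  qed
  then have "max_face m (closed_segment a b + closed_segment v v') = closed_segment a b + {v}"
    using 1 max_face_plus[of "closed_segment a b" "closed_segment v v'" m] by auto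
  moreover have "convex (closed_segment a b + closed_segment v v')" by (simp add: convex_set_plus)
  ultimately show ?thesis using max_face_face_of by metis
qed

locale parallelogramic =
  fixes P Q :: "'a::euclidean_space set"
  assumes P: "polytope P" "P \<noteq> {}" and Q: "polytope Q" "Q \<noteq> {}"
    and position: "parallelogramic_position P Q"
begin

lemma polytope_sum: "polytope (P + Q)" "P + Q \<noteq> {}"
  using polytope_plus[OF P(1) Q(1)] P(2) Q(2) by auto

lemma two_generic_edges:
  "closed_segment a b \<in> edge_set P \<Longrightarrow> two_generic Q (b - a)"
  "closed_segment x y \<in> edge_set Q \<Longrightarrow> two_generic P (y - x)"
  using position unfolding parallelogramic_position_def by blast+

text \<open>The definition excludes scalar multiples in one direction; edge directions are nonzero,
  so the other direction follows by inverting the scalar.\<close>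

lemma edges_not_parallel:
  assumes "closed_segment a b \<in> edge_set P" "closed_segment x y \<in> edge_set Q"
  shows "b - a \<notin> span {y - x}" "y - x \<notin> span {b - a}"
proof -
  have n: "b - a \<noteq> \<alpha> *\<^sub>R (y - x)" for \<alpha>
    using assms position unfolding parallelogramic_position_def by blast
  then show "b - a \<notin> span {y - x}" by (auto simp: span_singleton)
  show "y - x \<notin> span {b - a}"
  proof
    assume "y - x \<in> span {b - a}"
    then obtain \<alpha> where \<alpha>: "y - x = \<alpha> *\<^sub>R (b - a)" by (auto simp: span_singleton)
    have "y \<noteq> x" using assms edge_set_segment by blast
    then have "\<alpha> \<noteq> 0" using \<alpha> by auto
    then have "b - a = (1 / \<alpha>) *\<^sub>R (y - x)" using \<alpha> by simp
    then show False using n by blast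
  qed
qed

text \<open>Gives the statements about edges and polygons of \<open>P\<close> for those of
  \<open>Q\<close> as well.\<close>

lemma swapped: "parallelogramic Q P"
proof
  show "parallelogramic_position Q P"
    using position edges_not_parallel(2) unfolding parallelogramic_position_def span_singleton by blast
qed (use P Q in auto)

lemma translate_edge_iff:
  assumes "e \<in> edge_set P"
  shows "e + {v} \<in> edge_set (P + Q) \<longleftrightarrow> e + {v} face_of P + Q"
  using assms by (simp add: edge_set_def edge_of_def aff_dim_plus_singleton)

lemma exists_translate_edge:
  assumes e: "e \<in> edge_set P"
  obtains v where "v extreme_point_of Q" "e + {v} \<in> edge_set (P + Q)"
proof -
  obtain a b where ab: "e = closed_segment a b" "a \<noteq> b" using edge_setE[OF P(1) e] by blast
  have "e face_of P" "e \<noteq> {}" using e ab by (auto simp: edge_set_def edge_of_def)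
  moreover have "y - x \<in> span {b - a}" if "x \<in> e" "y \<in> e" for x y
    using segment_diff_span that ab by blast
  moreover have "y - x \<notin> span {b - a}" if "closed_segment x y \<in> edge_set Q" for x y
    using edges_not_parallel(2) that e ab by blast
  ultimately obtain v where "v extreme_point_of Q" "e + {v} face_of P + Q"
    using exists_vertex_translate[OF P Q, of e "{b - a}"] by blast
  then show ?thesis using that translate_edge_iff[OF e] by blast
qed

text \<open>2-genericity keeps every edge direction of \<open>Q\<close> outside the direction plane
  of \<open>F\<close>, as \<open>exists_vertex_translate\<close> demands.\<close>

lemma exists_translate_polygon:
  assumes F: "F face_of P" "aff_dim F = 2"
  obtains v where "v extreme_point_of Q" "F + {v} face_of P + Q"
proof -
  obtain L where L: "\<And>H v x y. F + {v} \<subseteq> H \<Longrightarrow> aff_dim H = 2 \<Longrightarrow> x \<in> H \<Longrightarrow> y \<in> H \<Longrightarrow> y - x \<in> span L"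
    "\<And>\<delta>. two_generic P \<delta> \<Longrightarrow> \<delta> \<notin> span L"
    using two_face_span[OF P(1) F] by blast
  have "F \<noteq> {}" using F by auto
  moreover have "y - x \<in> span L" if "x \<in> F" "y \<in> F" for x y
    using L(1)[of 0 F x y] F(2) that by simp
  moreover have "y - x \<notin> span L" if "closed_segment x y \<in> edge_set Q" for x y
    using L(2) two_generic_edges that by blast
  ultimately show ?thesis
    using exists_vertex_translate[OF P Q F(1), of L] that by blast
qed

text \<open>The polygon obtained by pivoting about \<open>e + {v}\<close> is the sum of \<open>e\<close> and an edge of \<open>Q\<close>:
  2-genericity excludes every other way to write a polygon as a sum of faces.\<close>
lemma parallelogram_step:
  assumes q: "edge_potential (P + Q) l q" and e: "e \<in> edge_set P"
    and v: "v extreme_point_of Q" "e + {v} \<in> edge_set (P + Q)"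
    and v1: "v1 \<in> Q" "e + {v1} = max_face c (P + Q)" "v \<noteq> v1"
  obtains v' where "v' extreme_point_of Q" "e + {v'} \<in> edge_set (P + Q)" "c \<bullet> v' > c \<bullet> v"
    "l (e + {v'}) = l (e + {v})"
proof -
  obtain a b where ab: "e = closed_segment a b" "a \<noteq> b" using edge_setE[OF P(1) e] by blast
  have eP: "e \<subseteq> P" "a \<in> e" "b \<in> e" "e face_of P" using e ab
    by (auto simp: edge_set_def edge_of_def dest: face_of_imp_subset)
  have vQ: "v \<in> Q" using v by (simp add: extreme_point_of_def)
  have PQ: "max_face c P + max_face c Q = e + {v1}" using max_face_plus[OF P(2) Q(2)] v1 by metis
  have split: "x \<in> max_face c P \<and> y \<in> max_face c Q" if "x \<in> P" "y \<in> Q" "x + y \<in> e + {v1}" for x y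
    using max_face_plusD that v1 by metis
  have f1: "e + {v1} face_of P + Q"
    using v1 max_face_face_of polytope_sum polytope_imp_convex by metis
  have eA: "e = max_face c P" and v1B: "v1 \<in> max_face c Q"
    using plus_singleton_face[OF P Q f1 _ eP(1) v1(1) PQ[symmetric] split] eP by auto
  \<comment> \<open>Otherwise \<open>e + {v}\<close> would lie in the \<open>c\<close>-face
    \<open>e + {v1}\<close>, and the bounded set \<open>e\<close> would contain its own translate by
    \<open>v - v1\<close>.\<close>
  have vB: "v \<notin> max_face c Q"
  proof
    assume "v \<in> max_face c Q"
    have "x + (v - v1) \<in> e" if "x \<in> e" for x
    proof -
      have "x + v \<in> e + {v1}" using PQ eA \<open>v \<in> max_face c Q\<close> that by blast
      then show ?thesis by (simp add: plus_singleton_iff algebra_simps)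
    qed
    then have "v - v1 = 0" using translate_subset_bounded[of e "v - v1"] eP ab by auto
    then show False using v1 by simp
  qed
  define k where "k = c \<bullet> a + c \<bullet> v"
  have k: "c \<bullet> x = k" if x: "x \<in> e + {v}" for x
  proof -
    have "x - v \<in> max_face c P" "a \<in> max_face c P" using x eA eP by (auto simp: plus_singleton_iff)
    then show ?thesis using max_face_eq[of a c P "x - v"] by (simp add: k_def inner_diff_right)
  qed
  have "c \<bullet> (a + v1) > k" using max_face_less[OF v1B vQ vB] by (simp add: k_def inner_add_right)
  moreover have "a + v1 \<in> P + Q" using eP v1 by blast
  moreover have fv: "e + {v} face_of P + Q" using v translate_edge_iff[OF e] by blast
  moreover have "e + {v} \<noteq> {}" using eP by blast
  ultimately obtain G where G: "G face_of P + Q" "e + {v} \<subseteq> G" "aff_dim G = aff_dim (e + {v}) + 1"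
    "\<And>x. x \<in> G \<Longrightarrow> x \<notin> e + {v} \<Longrightarrow> c \<bullet> x > k"
    using pivot[OF polytope_sum(1) fv _ k] by blast
  have dim_ev: "aff_dim (e + {v}) = 1" using v(2) by (simp add: edge_set_def edge_of_def)
  then have dimG: "aff_dim G = 2" using G by simp
  then have "G \<noteq> {}" by auto
  then obtain A B where AB: "G = A + B" "A face_of P" "A \<noteq> {}" "B face_of Q" "B \<noteq> {}"
    "\<And>x y. x \<in> P \<Longrightarrow> y \<in> Q \<Longrightarrow> x + y \<in> G \<Longrightarrow> x \<in> A \<and> y \<in> B"
    using face_of_plusE[OF P Q G(1)] by blast
  have pB: "polytope B" using AB Q face_of_polytope_polytope by blast
  have avG: "a + v \<in> G" "b + v \<in> G" using G(2) eP by blast+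
  have eA': "e \<subseteq> A" and vB': "v \<in> B" using AB(6)[OF _ vQ] G(2) eP by blast+
  have vB_ext: "v extreme_point_of B" using v AB vB' extreme_point_of_face by blast
  have nGe: "G \<noteq> e + {v}" using dimG dim_ev by auto
  \<comment> \<open>A larger \<open>A\<close> would be a polygon. If \<open>B = {v}\<close>, then
    \<open>c\<close> could not grow off \<open>e + {v}\<close>, because \<open>e\<close> is already
    the \<open>c\<close>-maximal face of \<open>P\<close>; otherwise \<open>B\<close> has an edge
    direction in the plane of \<open>A\<close>, against 2-genericity.\<close>
  have "A = e"
  proof (rule ccontr)
    assume "A \<noteq> e"
    have "e face_of A" using eA' AB eP face_of_face by blast
    then have "aff_dim e < aff_dim A"
      using face_of_aff_dim_lt[of A e] \<open>A \<noteq> e\<close> AB P face_of_polytope_polytope polytope_imp_convex by metis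
    moreover have "aff_dim e = 1" using e by (simp add: edge_set_def edge_of_def)
    moreover have sub: "A + {v} \<subseteq> G" using AB vB' by (auto elim!: set_plus_elim)
    then have "aff_dim A \<le> 2" using aff_dim_subset[OF sub] dimG by (simp add: aff_dim_plus_singleton)
    ultimately have dimA: "aff_dim A = 2" by simp
    obtain L where L: "\<And>H v x y. A + {v} \<subseteq> H \<Longrightarrow> aff_dim H = 2 \<Longrightarrow> x \<in> H \<Longrightarrow> y \<in> H \<Longrightarrow> y - x \<in> span L"
      "\<And>\<delta>. two_generic P \<delta> \<Longrightarrow> \<delta> \<notin> span L"
      using two_face_span[OF P(1) AB(2) dimA] by blast
    show False
    proof (cases "B = {v}")
      case True
      obtain x where x: "x \<in> A" "x \<notin> e" using eA' \<open>A \<noteq> e\<close> by blast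
      have "x + v \<in> G" using sub x by blast
      moreover have "x + v \<notin> e + {v}" using x by (simp add: plus_singleton_iff)
      ultimately have "c \<bullet> (x + v) > k" using G(4) by blast
      moreover have "x \<in> P" using x AB face_of_imp_subset by blast
      then have "c \<bullet> x \<le> c \<bullet> a" using eA eP max_face_le by blast
      ultimately show False by (simp add: k_def inner_add_right)
    next
      case False
      then obtain x where "x \<in> B" "x \<noteq> v" using vB' by blast
      then obtain v' where v': "closed_segment v v' \<in> edge_set B"
        using edge_at_vertex[OF pB vB_ext] by blast
      have "a + v' \<in> G" using AB eA' eP v' edge_set_subset by blast
      then have "(a + v') - (a + v) \<in> span L" using L(1)[OF sub dimG avG(1)] by blast
      moreover have "two_generic P (v' - v)"
        using two_generic_edges(2) v' edge_set_face[OF AB(4)] by blast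
      ultimately show False using L(2) by simp
    qed
  qed
  have "B \<noteq> {v}" using nGe AB \<open>A = e\<close> by blast
  then obtain x where "x \<in> B" "x \<noteq> v" using vB' by blast
  then obtain v' where v': "closed_segment v v' \<in> edge_set B"
    using edge_at_vertex[OF pB vB_ext] by blast
  have v'Q: "closed_segment v v' \<in> edge_set Q" using v' edge_set_face[OF AB(4)] by blast
  have vv': "v \<noteq> v'" using v'Q edge_set_segment by blast
  have np: "b - a \<notin> span {v' - v}" "v' - v \<notin> span {b - a}"
    using edges_not_parallel v'Q e ab by auto
  have np': "a - b \<notin> span {v' - v}" "v - v' \<notin> span {b - a}"
    using np by (metis minus_diff_eq span_neg)+
  \<comment> \<open>A larger \<open>B\<close> would be a polygon whose plane contains the direction
    of \<open>e\<close>, against 2-genericity.\<close>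
  have BS: "B = closed_segment v v'"
  proof (rule ccontr)
    assume ne: "B \<noteq> closed_segment v v'"
    have "closed_segment v v' face_of B" "v \<noteq> v'" using v' edge_set_segment by auto
    then have "1 < aff_dim B"
      using face_of_aff_dim_lt[of B "closed_segment v v'"] ne pB polytope_imp_convex aff_dim_segment[of v v'] by auto
    moreover have sub: "B + {a} \<subseteq> G" using AB eP \<open>A = e\<close> by (auto elim!: set_plus_elim simp: add.commute)
    then have "aff_dim B \<le> 2" using aff_dim_subset[OF sub] dimG by (simp add: aff_dim_plus_singleton)
    ultimately have dimB: "aff_dim B = 2" by simp
    obtain L where L: "\<And>H v x y. B + {v} \<subseteq> H \<Longrightarrow> aff_dim H = 2 \<Longrightarrow> x \<in> H \<Longrightarrow> y \<in> H \<Longrightarrow> y - x \<in> span L"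
      "\<And>\<delta>. two_generic Q \<delta> \<Longrightarrow> \<delta> \<notin> span L"
      using two_face_span[OF Q(1) AB(4) dimB] by blast
    have "(b + v) - (a + v) \<in> span L" using L(1)[OF sub dimG avG] .
    moreover have "two_generic Q (b - a)" using two_generic_edges(1) e ab by blast
    ultimately show False using L(2) by simp
  qed
  have G_eq: "G = closed_segment a b + closed_segment v v'" "G = closed_segment v v' + closed_segment a b"
    using AB(1) \<open>A = e\<close> BS ab add.commute by metis+
  have "closed_segment a b + {v'} face_of G"
    unfolding G_eq(1) closed_segment_commute[of v v'] by (rule segment_face_of_parallelogram) (rule np)
  then have ev': "e + {v'} \<in> edge_set (P + Q)"
    using translate_edge_iff[OF e] face_of_trans G(1) ab by blast
  have "closed_segment v v' + {a} face_of G"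
    unfolding G_eq(2) by (rule segment_face_of_parallelogram) (rule np')
  then have af: "closed_segment (a + v) (a + v') \<in> edge_set (P + Q)"
    using face_of_trans[OF _ G(1)] vv'
    by (simp add: edge_set_segment closed_segment_plus_singleton add.commute)
  have "closed_segment v v' + {b} face_of G"
    unfolding G_eq(2) closed_segment_commute[of a b] by (rule segment_face_of_parallelogram) (rule np)
  then have bf: "closed_segment (b + v) (b + v') \<in> edge_set (P + Q)"
    using face_of_trans[OF _ G(1)] vv'
    by (simp add: edge_set_segment closed_segment_plus_singleton add.commute)
  have "a + v' \<in> G" using AB eP \<open>A = e\<close> BS by blast
  moreover have "a + v' \<notin> e + {v}"
  proof
    assume "a + v' \<in> e + {v}"
    then have "a + v' - v \<in> closed_segment a b" using ab by (simp add: plus_singleton_iff)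
    then have "(a + v' - v) - a \<in> span {b - a}" using segment_diff_span ends_in_segment(1) by blast
    then show False using np by (simp add: algebra_simps)
  qed
  ultimately have "c \<bullet> (a + v') > k" using G(4) by blast
  then have up: "c \<bullet> v' > c \<bullet> v" by (simp add: k_def inner_add_right)
  have "q (a + v) - q (b + v) = l (e + {v}) *\<^sub>R (a - b)"
    using edge_potentialD[OF q, of "a + v" "b + v"] v(2) ab by (simp add: closed_segment_plus_singleton)
  moreover have "q (a + v') - q (b + v') = l (e + {v'}) *\<^sub>R (a - b)"
    using edge_potentialD[OF q, of "a + v'" "b + v'"] ev' ab by (simp add: closed_segment_plus_singleton)
  moreover obtain s where "q (a + v) - q (a + v') = s *\<^sub>R (v - v')"
    using edge_potentialD[OF q af] by auto
  moreover obtain t where "q (b + v) - q (b + v') = t *\<^sub>R (v - v')"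
    using edge_potentialD[OF q bf] by auto
  moreover have "(q (a + v) - q (b + v)) - (q (a + v') - q (b + v')) =
      (q (a + v) - q (a + v')) - (q (b + v) - q (b + v'))" by (simp add: algebra_simps)
  \<comment> \<open>The differences of \<open>q\<close> around the parallelogram sum to zero. This
    equates a multiple of one side with a multiple of the other, and the sides are not
    parallel.\<close>
  ultimately have eq: "(l (e + {v}) - l (e + {v'})) *\<^sub>R (a - b) = (s - t) *\<^sub>R (v - v')"
    by (simp add: scaleR_diff_left)
  have "l (e + {v'}) = l (e + {v})"
  proof (rule ccontr)
    assume "\<not> ?thesis"
    then have "a - b = (1 / (l (e + {v}) - l (e + {v'}))) *\<^sub>R ((l (e + {v}) - l (e + {v'})) *\<^sub>R (a - b))" by simp
    also have "\<dots> = ((t - s) / (l (e + {v}) - l (e + {v'}))) *\<^sub>R (v' - v)"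
      unfolding eq by (simp add: algebra_simps diff_divide_distrib)
    finally have "a - b \<in> span {v' - v}" unfolding span_singleton by blast
    then show False using np' by blast
  qed
  moreover have "v' extreme_point_of Q" using v'Q edge_set_vertices by blast
  ultimately show ?thesis using that ev' up by blast
qed

text \<open>Let \<open>c\<close> expose \<open>h\<close>. From any other member, parallelogram steps
  raise \<open>c\<close> at the vertex of \<open>Q\<close>; since there are finitely many vertices,
  they end at \<open>h\<close>.\<close>

lemma class_constant:
  assumes q: "edge_potential (P + Q) l q" and e: "e \<in> edge_set P"
    and g: "g \<in> edge_class P Q (Inl e)" "h \<in> edge_class P Q (Inl e)"
  shows "l g = l h"
proof -
  obtain v1 where v1: "h = e + {v1}" "v1 extreme_point_of Q" "h \<in> edge_set (P + Q)" using g by auto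
  obtain v where v: "g = e + {v}" "v extreme_point_of Q" "g \<in> edge_set (P + Q)" using g by auto
  have "h face_of P + Q" "h \<noteq> {}" using v1 by (auto simp: edge_set_def edge_of_def)
  then obtain c where c: "e + {v1} = max_face c (P + Q)"
    using face_is_max_face[OF polytope_sum(1)] v1 by metis
  have v1Q: "v1 \<in> Q" using v1 by (simp add: extreme_point_of_def)
  have "l (e + {v}) = l (e + {v1})"
    using v(2,3) unfolding v(1)
  proof (induction "card {y. y extreme_point_of Q \<and> c \<bullet> v < c \<bullet> y}" arbitrary: v rule: less_induct)
    case less
    show ?case
    proof (cases "v = v1")
      case False
      obtain v' where v': "v' extreme_point_of Q" "e + {v'} \<in> edge_set (P + Q)" "c \<bullet> v' > c \<bullet> v"
        "l (e + {v'}) = l (e + {v})"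
        using parallelogram_step[OF q e less.prems v1Q c False] by blast
      have "{y. y extreme_point_of Q \<and> c \<bullet> v' < c \<bullet> y} \<subset> {y. y extreme_point_of Q \<and> c \<bullet> v < c \<bullet> y}"
        using v' by force
      moreover have "finite {y. y extreme_point_of Q \<and> c \<bullet> v < c \<bullet> y}"
        using finite_vertices[OF Q(1)] by simp
      ultimately have "l (e + {v'}) = l (e + {v1})"
        using less.hyps[of v'] v' psubset_card_mono by blast
      then show ?thesis using v' by simp
    qed simp
  qed
  then show ?thesis using v v1 by simp
qed

text \<open>The vertex \<open>v\<close> depends on the polygon \<open>F\<close>, so the potentials
  found here are only local. Hypothesis \<open>l1\<close> makes their edge lengths independent of
  \<open>v\<close>, which is all that \<open>edge_potential_global\<close> asks for.\<close>

lemma restrict_potential: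
  assumes q: "edge_potential (P + Q) l q"
    and l1: "\<And>e g. e \<in> edge_set P \<Longrightarrow> g \<in> edge_class P Q (Inl e) \<Longrightarrow> l g = l1 e"
  shows "\<exists>q1. edge_potential P l1 q1"
proof (rule edge_potential_global[OF P(1)])
  fix F assume F: "F face_of P" "aff_dim F = 2"
  obtain v where v: "v extreme_point_of Q" "F + {v} face_of P + Q"
    using exists_translate_polygon[OF F] by blast
  have "edge_potential F l1 (\<lambda>x. q (x + v))"
    unfolding edge_potential_def
  proof (intro allI impI)
    fix a b assume ab: "closed_segment a b \<in> edge_set F"
    then have e: "closed_segment a b \<in> edge_set P" using edge_set_face[OF F(1)] by blast
    have "closed_segment a b face_of F" using ab edge_set_segment by blast
    then have "closed_segment a b + {v} face_of F + {v}"
      by (simp add: plus_singleton_image)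
    then have e': "closed_segment a b + {v} \<in> edge_set (P + Q)"
      using translate_edge_iff[OF e] v face_of_trans by blast
    then have "l (closed_segment a b + {v}) = l1 (closed_segment a b)"
      using l1[OF e] v by auto
    then show "q (a + v) - q (b + v) = l1 (closed_segment a b) *\<^sub>R (a - b)"
      using edge_potentialD[OF q, of "a + v" "b + v"] e' by (simp add: closed_segment_plus_singleton)
  qed
  then show "\<exists>q. edge_potential F l1 q" by blast
qed

end

section \<open>Edge classes partition the edges of the sum; adding potentials\<close>

text \<open>The mixed sums \<open>x + y'\<close> and \<open>x' + y\<close> have midpoint
  \<open>w\<close>, so they coincide for an extreme point.\<close>

lemma extreme_point_of_plus_unique:
  fixes w :: "'a::euclidean_space"
  assumes w: "w extreme_point_of P + Q" and "w = x + y" "x \<in> P" "y \<in> Q" "w = x' + y'" "x' \<in> P" "y' \<in> Q"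
  shows "x = x'"
proof -
  have in_sum: "x + y' \<in> P + Q" "x' + y \<in> P + Q" using assms by blast+
  have "midpoint (x + y') (x' + y) = (1/2) *\<^sub>R ((x + y) + (x' + y'))"
    by (simp add: midpoint_def algebra_simps)
  also have "\<dots> = (1/2) *\<^sub>R (w + w)" using assms(2,5) by simp
  also have "\<dots> = w" by (simp add: scaleR_2[symmetric])
  finally have mid: "midpoint (x + y') (x' + y) = w" .
  have "x + y' = x' + y"
  proof (rule ccontr)
    assume "x + y' \<noteq> x' + y"
    then have "w \<in> open_segment (x + y') (x' + y)" using mid by (metis midpoint_in_open_segment)
    then show False using w in_sum by (auto simp: extreme_point_of_def)
  qed
  moreover have "x + y = x' + y'" using assms by simp
  ultimately have "(x + y') + (x + y) = (x' + y) + (x' + y')" by simp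
  then have "2 *\<^sub>R x = 2 *\<^sub>R x'" by (simp add: algebra_simps scaleR_2)
  then show ?thesis by simp
qed

context parallelogramic
begin

lemma edge_class_swap:
  "edge_class Q P (Inl f) = edge_class P Q (Inr f)"
  "edge_class Q P (Inr e) = edge_class P Q (Inl e)"
  by (simp_all add: add.commute)

lemma edge_class_subset: "edge_class P Q i \<subseteq> edge_set (P + Q)"
  by (cases i) auto

lemma edge_class_Inl_nonempty: "e \<in> edge_set P \<Longrightarrow> edge_class P Q (Inl e) \<noteq> {}"
  by (erule exists_translate_edge) auto

lemma edge_class_nonempty: "i \<in> edge_set P <+> edge_set Q \<Longrightarrow> edge_class P Q i \<noteq> {}"
  using edge_class_Inl_nonempty parallelogramic.edge_class_Inl_nonempty[OF swapped] edge_class_swap(1)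
  by (elim PlusE) blast+

text \<open>Both edges equal the summand in \<open>P\<close> of one decomposition of the face
  \<open>g\<close>.\<close>

lemma edge_class_Inl_unique:
  assumes "e \<in> edge_set P" "e' \<in> edge_set P" "g \<in> edge_class P Q (Inl e)" "g \<in> edge_class P Q (Inl e')"
  shows "e = e'"
proof -
  obtain v where v: "v extreme_point_of Q" "g = e + {v}" using assms by auto
  obtain v' where v': "v' extreme_point_of Q" "g = e' + {v'}" using assms by auto
  have g: "g face_of P + Q" "g \<noteq> {}" using assms by (auto simp: edge_set_def edge_of_def)
  obtain A B where AB: "g = A + B" "\<And>x y. x \<in> P \<Longrightarrow> y \<in> Q \<Longrightarrow> x + y \<in> g \<Longrightarrow> x \<in> A \<and> y \<in> B"
    using face_of_plusE[OF P Q g] by metis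
  have "e = A" if "e \<in> edge_set P" "v extreme_point_of Q" "g = e + {v}" for e v
  proof -
    have e: "e \<noteq> {}" "e \<subseteq> P"
      using that(1) by (auto simp: edge_set_def edge_of_def dest: face_of_imp_subset)
    have vQ: "v \<in> Q" using that(2) by (simp add: extreme_point_of_def)
    show ?thesis
      using plus_singleton_face(1)[OF P Q g(1)[unfolded that(3)] e vQ AB(1)[unfolded that(3)] AB(2)[unfolded that(3)]] .
  qed
  from this[OF assms(1) v] this[OF assms(2) v'] show ?thesis by simp
qed

lemma edge_class_Inl_Inr_disjoint:
  assumes "e \<in> edge_set P" "f \<in> edge_set Q" "g \<in> edge_class P Q (Inl e)"
  shows "g \<notin> edge_class P Q (Inr f)"
proof
  assume "g \<in> edge_class P Q (Inr f)"
  then obtain u where u: "g = f + {u}" by auto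
  obtain v where v: "g = e + {v}" using assms by auto
  obtain a b where ab: "e = closed_segment a b" using edge_setE[OF P(1) assms(1)] by blast
  obtain x y where xy: "f = closed_segment x y" using edge_setE[OF Q(1) assms(2)] by blast
  have "a + v \<in> f + {u}" "b + v \<in> f + {u}" using u v ab by auto
  then have "a + v - u \<in> closed_segment x y" "b + v - u \<in> closed_segment x y"
    using xy by (simp_all add: plus_singleton_iff)
  from segment_diff_span[OF this] have "b - a \<in> span {y - x}" by simp
  then show False using edges_not_parallel(1) assms ab xy by blast
qed

lemma edge_class_unique:
  assumes "i \<in> edge_set P <+> edge_set Q" "j \<in> edge_set P <+> edge_set Q"
    "g \<in> edge_class P Q i" "g \<in> edge_class P Q j"
  shows "i = j"
proof (cases i)
  case i: (Inl e)
  then have e: "e \<in> edge_set P" "g \<in> edge_class P Q (Inl e)" using assms by auto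
  show ?thesis
  proof (cases j)
    case (Inl e')
    then have "e' \<in> edge_set P" "g \<in> edge_class P Q (Inl e')" using assms by auto
    then show ?thesis using edge_class_Inl_unique[OF e(1) _ e(2)] i Inl by simp
  next
    case (Inr f)
    then have "f \<in> edge_set Q" "g \<in> edge_class P Q (Inr f)" using assms by auto
    then show ?thesis using edge_class_Inl_Inr_disjoint[OF e(1) _ e(2)] by blast
  qed
next
  case i: (Inr f)
  then have f: "f \<in> edge_set Q" "g \<in> edge_class P Q (Inr f)" using assms by auto
  show ?thesis
  proof (cases j)
    case (Inl e)
    then have "e \<in> edge_set P" "g \<in> edge_class P Q (Inl e)" using assms by auto
    then show ?thesis using edge_class_Inl_Inr_disjoint[OF _ f(1)] f(2) by blast
  next
    case (Inr f')
    then have "f' \<in> edge_set Q" "g \<in> edge_class Q P (Inl f')" "g \<in> edge_class Q P (Inl f)"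
      using assms f(2) by (simp_all only: edge_class_swap) auto
    then show ?thesis
      using parallelogramic.edge_class_Inl_unique[OF swapped f(1), of f' g] i Inr by simp
  qed
qed

text \<open>If neither summand of \<open>g\<close> were a point, each would contain an edge parallel
  to \<open>g\<close>, and these edges of \<open>P\<close> and \<open>Q\<close> would be parallel to
  each other.\<close>

lemma edge_class_cover:
  assumes g: "g \<in> edge_set (P + Q)"
  obtains i where "i \<in> edge_set P <+> edge_set Q" "g \<in> edge_class P Q i"
proof -
  have gf: "g face_of P + Q" and dim: "aff_dim g = 1" using g by (auto simp: edge_set_def edge_of_def)
  then have "g \<noteq> {}" by auto
  then obtain A B where AB: "g = A + B" "A face_of P" "A \<noteq> {}" "B face_of Q" "B \<noteq> {}"
    by (rule face_of_plusE[OF P Q gf])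
  have pA: "polytope A" and pB: "polytope B" using AB P Q face_of_polytope_polytope by blast+
  obtain u where u: "u extreme_point_of A" using polytope_max_vertex[OF pA] AB by blast
  obtain v where v: "v extreme_point_of B" using polytope_max_vertex[OF pB] AB by blast
  have uA: "u \<in> A" and vB: "v \<in> B" using u v by (auto simp: extreme_point_of_def)
  have uv: "u extreme_point_of P" "v extreme_point_of Q"
    using u v AB extreme_point_of_face by blast+
  show ?thesis
  proof (cases "A = {u}")
    case True
    then have eq: "g = B + {u}" using AB(1) add.commute by metis
    then have "B \<in> edge_set Q" using dim AB(2,4) by (simp add: aff_dim_plus_singleton edge_set_def edge_of_def)
    then show ?thesis using that[of "Inr B"] eq g uv by auto
  next
    case nA: False
    show ?thesis
    proof (cases "B = {v}")
      case True
      then have eq: "g = A + {v}" using AB(1) by metis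
      then have "A \<in> edge_set P" using dim AB(2,4) by (simp add: aff_dim_plus_singleton edge_set_def edge_of_def)
      then show ?thesis using that[of "Inl A"] eq g uv by auto
    next
      case False
      then obtain y where "y \<in> B" "y \<noteq> v" using vB by blast
      then obtain y where y: "closed_segment v y \<in> edge_set B" using edge_at_vertex[OF pB v] by blast
      obtain x where "x \<in> A" "x \<noteq> u" using nA uA by blast
      then obtain x where x: "closed_segment u x \<in> edge_set A" using edge_at_vertex[OF pA u] by blast
      obtain p p' where pp: "g = closed_segment p p'" using edge_setE[OF polytope_sum(1) g] by blast
      have "u + v \<in> g" "x + v \<in> g" "u + y \<in> g" using AB uA vB x y edge_set_subset by blast+
      then have "(x + v) - (u + v) \<in> span {p' - p}" "(u + y) - (u + v) \<in> span {p' - p}"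
        unfolding pp using segment_diff_span by blast+
      then have s: "x - u \<in> span {p' - p}" "y - v \<in> span {p' - p}" by simp_all
      have eP: "closed_segment u x \<in> edge_set P" using x edge_set_face[OF AB(2)] by blast
      have eQ: "closed_segment v y \<in> edge_set Q" using y edge_set_face[OF AB(4)] by blast
      obtain \<alpha> \<beta> where ab: "x - u = \<alpha> *\<^sub>R (p' - p)" "y - v = \<beta> *\<^sub>R (p' - p)"
        using s by (auto simp: span_singleton)
      have "y \<noteq> v" using eQ edge_set_segment by blast
      then have "\<beta> \<noteq> 0" using ab by auto
      then have "x - u = (\<alpha> / \<beta>) *\<^sub>R (y - v)" using ab by simp
      then have "x - u \<in> span {y - v}" unfolding span_singleton by blast
      then show ?thesis using edges_not_parallel(1)[OF eP eQ] by blast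
    qed
  qed
qed

text \<open>A segment determines only its unordered pair of ends; \<open>a\<close> and
  \<open>b\<close> are named so that they match \<open>p\<close> and \<open>p'\<close> in
  order.\<close>

lemma edge_of_sum_cases:
  assumes "closed_segment p p' \<in> edge_set (P + Q)"
  obtains (left) a b v where "closed_segment a b \<in> edge_set P" "v extreme_point_of Q" "p = a + v" "p' = b + v"
      "closed_segment p p' \<in> edge_class P Q (Inl (closed_segment a b))"
  | (right) a b v where "closed_segment a b \<in> edge_set Q" "v extreme_point_of P" "p = a + v" "p' = b + v"
      "closed_segment p p' \<in> edge_class P Q (Inr (closed_segment a b))"
proof -
  have seg: "\<exists>a b. e = closed_segment a b \<and> p = a + v \<and> p' = b + v"
    if S: "polytope S" "e \<in> edge_set S" "closed_segment p p' = e + {v}" for e v and S :: "'a set"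
  proof -
    obtain a b where ab: "e = closed_segment a b" using edge_setE[OF S(1,2)] by blast
    then have "closed_segment p p' = closed_segment (a + v) (b + v)"
      using S by (simp add: closed_segment_plus_singleton)
    then have "{p, p'} = {a + v, b + v}" by (simp add: closed_segment_eq)
    then have "p = a + v \<and> p' = b + v \<or> p = b + v \<and> p' = a + v" by (auto simp: doubleton_eq_iff)
    then show ?thesis using ab closed_segment_commute by blast
  qed
  obtain i where i: "i \<in> edge_set P <+> edge_set Q" "closed_segment p p' \<in> edge_class P Q i"
    using edge_class_cover[OF assms] .
  show ?thesis
  proof (cases i)
    case (Inl e)
    then obtain v where v: "v extreme_point_of Q" "closed_segment p p' = e + {v}" "e \<in> edge_set P" using i by auto
    obtain a b where ab: "e = closed_segment a b" "p = a + v" "p' = b + v"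
      using seg[OF P(1) v(3,2)] by blast
    have "closed_segment p p' \<in> edge_class P Q (Inl e)" using i(2) Inl by simp
    then show ?thesis using v(1,3) ab by (intro left[of a b v]) simp_all
  next
    case (Inr f)
    then obtain v where v: "v extreme_point_of P" "closed_segment p p' = f + {v}" "f \<in> edge_set Q" using i by auto
    obtain a b where ab: "f = closed_segment a b" "p = a + v" "p' = b + v"
      using seg[OF Q(1) v(3,2)] by blast
    have "closed_segment p p' \<in> edge_class P Q (Inr f)" using i(2) Inr by simp
    then show ?thesis using v(1,3) ab by (intro right[of a b v]) simp_all
  qed
qed

text \<open>Along an edge of the sum only one of the two components of the vertex changes, so
  \<open>q1\<close> and \<open>q2\<close> of the components add up to a potential.\<close>

lemma extend_potential:
  assumes q1: "edge_potential P l1 q1" and q2: "edge_potential Q l2 q2"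
    and l: "\<And>i g. i \<in> edge_set P <+> edge_set Q \<Longrightarrow> g \<in> edge_class P Q i \<Longrightarrow> l g = case_sum l1 l2 i"
  shows "\<exists>q. edge_potential (P + Q) l q"
proof -
  \<comment> \<open>The component in \<open>P\<close>; at vertices of the sum the choice is forced
    by uniqueness of the decomposition.\<close>
  define d where "d w = (SOME x. x \<in> P \<and> w - x \<in> Q)" for w
  have d: "d w = x" if "w extreme_point_of P + Q" "w = x + y" "x \<in> P" "y \<in> Q" for w x y
  proof -
    have "x \<in> P \<and> w - x \<in> Q" using that by simp
    then have "d w \<in> P \<and> w - d w \<in> Q" unfolding d_def by (rule someI)
    then show ?thesis using extreme_point_of_plus_unique[OF that(1), of "d w" "w - d w" x y] that by simp
  qed
  have "edge_potential (P + Q) l (\<lambda>w. q1 (d w) + q2 (w - d w))"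
    unfolding edge_potential_def
  proof (intro allI impI)
    fix p p' assume e: "closed_segment p p' \<in> edge_set (P + Q)"
    note ext = edge_set_vertices[OF e]
    from e show "q1 (d p) + q2 (p - d p) - (q1 (d p') + q2 (p' - d p')) = l (closed_segment p p') *\<^sub>R (p - p')"
    proof (cases rule: edge_of_sum_cases)
      case (left a b v)
      have "a \<in> P" "b \<in> P" "v \<in> Q" using left edge_set_subset by (auto simp: extreme_point_of_def)
      then have "d p = a" "d p' = b" using d ext left by blast+
      moreover have "l (closed_segment p p') = l1 (closed_segment a b)" using l[of "Inl (closed_segment a b)"] left by auto
      ultimately show ?thesis using edge_potentialD[OF q1 left(1)] left(3,4) by simp
    next
      case (right a b v)
      have "a \<in> Q" "b \<in> Q" "v \<in> P" using right edge_set_subset by (auto simp: extreme_point_of_def)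
      then have "d p = v" "d p' = v"
        using d[OF ext(1), of v a] d[OF ext(2), of v b] right by (simp_all add: add.commute)
      moreover have "l (closed_segment p p') = l2 (closed_segment a b)" using l[of "Inr (closed_segment a b)"] right by auto
      ultimately show ?thesis using edge_potentialD[OF q2 right(1)] right(3,4) by simp
    qed
  qed
  then show ?thesis by blast
qed

end

section \<open>Splitting the deformation cone\<close>

lemma lookup_scaleR: "Poly_Mapping.lookup (r *\<^sub>R x) i = r *\<^sub>R Poly_Mapping.lookup x i"
proof -
  have "finite {i. r *\<^sub>R Poly_Mapping.lookup x i \<noteq> 0}"
    by (rule finite_subset[OF _ finite_lookup[of x]]) auto
  then show ?thesis by (simp add: scaleR_poly_mapping_def)
qed

definition poly_mapping_on :: "'k set \<Rightarrow> ('k \<Rightarrow> 'b::comm_monoid_add) \<Rightarrow> 'k \<Rightarrow>\<^sub>0 'b" where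
  "poly_mapping_on E f = (\<Sum>e\<in>E. Poly_Mapping.single e (f e))"

lemma lookup_poly_mapping_on:
  "finite E \<Longrightarrow> Poly_Mapping.lookup (poly_mapping_on E f) e = (if e \<in> E then f e else 0)"
  by (simp add: poly_mapping_on_def lookup_sum lookup_single when_def sum.delta)

lemma keys_poly_mapping_on: "finite E \<Longrightarrow> Poly_Mapping.keys (poly_mapping_on E f) \<subseteq> E"
  by (auto simp: in_keys_iff lookup_poly_mapping_on split: if_splits)

lemma zero_in_deformation_cone:
  fixes S :: "'a::euclidean_space set"
  assumes "polytope S" "S \<noteq> {}" shows "0 \<in> deformation_cone S"
  using assms by (auto simp: deformation_cone_iff edge_potential_def intro!: exI[of _ "\<lambda>_. 0"])

text \<open>This is \<open>S\<close> as a deformation of itself, with the identity as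
  potential.\<close>

lemma ones_in_deformation_cone:
  fixes S :: "'a::euclidean_space set"
  assumes "polytope S" "S \<noteq> {}" shows "poly_mapping_on (edge_set S) (\<lambda>_. 1) \<in> deformation_cone S"
  unfolding deformation_cone_iff[OF assms] edge_potential_def
  using keys_poly_mapping_on[OF finite_edge_set[OF assms(1)]]
  by (auto simp: lookup_poly_mapping_on finite_edge_set[OF assms(1)] intro!: exI[of _ "\<lambda>x. x"])

context parallelogramic
begin

abbreviation "index_set \<equiv> edge_set P <+> edge_set Q"

text \<open>Fixed independently of \<open>l\<close>, so that reading off coordinates is linear on
  the whole space; on the deformation cone any other member gives the same value.\<close>

definition rep :: "'a set + 'a set \<Rightarrow> 'a set" where
  "rep i = (SOME g. g \<in> edge_class P Q i)"

lemma rep: "i \<in> index_set \<Longrightarrow> rep i \<in> edge_class P Q i"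
  unfolding rep_def using edge_class_nonempty some_in_eq by blast

lemma rep_edge: "i \<in> index_set \<Longrightarrow> rep i \<in> edge_set (P + Q)"
  using rep edge_class_subset by blast

lemma class_constant_all:
  assumes q: "edge_potential (P + Q) l q" and i: "i \<in> index_set"
    and g: "g \<in> edge_class P Q i" "h \<in> edge_class P Q i"
  shows "l g = l h"
proof (cases i)
  case (Inl e)
  then show ?thesis using class_constant[OF q, of e g h] i g by auto
next
  case (Inr f)
  have q': "edge_potential (Q + P) l q" using q by (simp add: add.commute)
  have "f \<in> edge_set Q" "g \<in> edge_class Q P (Inl f)" "h \<in> edge_class Q P (Inl f)"
    using Inr i g by (simp_all only: edge_class_swap) auto
  then show ?thesis using parallelogramic.class_constant[OF swapped q'] by blast
qed

definition split :: "('a set \<Rightarrow>\<^sub>0 real) \<Rightarrow> ('a set \<Rightarrow>\<^sub>0 real) \<times> ('a set \<Rightarrow>\<^sub>0 real)" where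
  "split l = (poly_mapping_on (edge_set P) (\<lambda>e. Poly_Mapping.lookup l (rep (Inl e))),
              poly_mapping_on (edge_set Q) (\<lambda>f. Poly_Mapping.lookup l (rep (Inr f))))"

lemma finite_edges: "finite (edge_set P)" "finite (edge_set Q)" "finite (edge_set (P + Q))"
  using finite_edge_set P Q polytope_sum by blast+

lemma lookup_split:
  assumes "i \<in> index_set"
  shows "case_sum (Poly_Mapping.lookup (fst (split l))) (Poly_Mapping.lookup (snd (split l))) i =
    Poly_Mapping.lookup l (rep i)"
  using assms finite_edges by (auto simp: split_def lookup_poly_mapping_on)

lemma linear_split: "linear split"
proof (rule linearI)
  fix x y show "split (x + y) = split x + split y"
    by (auto simp: split_def prod_eq_iff lookup_poly_mapping_on finite_edges lookup_add intro!: poly_mapping_eqI)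
next
  fix r x show "split (r *\<^sub>R x) = r *\<^sub>R split x"
    by (auto simp: split_def prod_eq_iff lookup_poly_mapping_on finite_edges lookup_scaleR intro!: poly_mapping_eqI)
qed

lemma lookup_deformation:
  assumes l: "l \<in> deformation_cone (P + Q)" and i: "i \<in> index_set" and g: "g \<in> edge_class P Q i"
  shows "Poly_Mapping.lookup l g = Poly_Mapping.lookup l (rep i)"
  using l class_constant_all[OF _ i g rep[OF i]] by (auto simp: deformation_cone_iff[OF polytope_sum])

lemma split_deformation:
  assumes l: "l \<in> deformation_cone (P + Q)"
  shows "split l \<in> deformation_cone P \<times> deformation_cone Q"
proof -
  obtain q where q: "edge_potential (P + Q) (Poly_Mapping.lookup l) q"
    and pos: "\<And>g. g \<in> edge_set (P + Q) \<Longrightarrow> 0 \<le> Poly_Mapping.lookup l g"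
    using l by (auto simp: deformation_cone_iff[OF polytope_sum])
  have q': "edge_potential (Q + P) (Poly_Mapping.lookup l) q" using q by (simp add: add.commute)
  have val1: "Poly_Mapping.lookup (fst (split l)) e = Poly_Mapping.lookup l (rep (Inl e))" if "e \<in> edge_set P" for e
    using that lookup_split[of "Inl e" l] by auto
  have val2: "Poly_Mapping.lookup (snd (split l)) f = Poly_Mapping.lookup l (rep (Inr f))" if "f \<in> edge_set Q" for f
    using that lookup_split[of "Inr f" l] by auto
  have "\<exists>q1. edge_potential P (Poly_Mapping.lookup (fst (split l))) q1"
  proof (rule restrict_potential[OF q])
    fix e g assume e: "e \<in> edge_set P" "g \<in> edge_class P Q (Inl e)"
    show "Poly_Mapping.lookup l g = Poly_Mapping.lookup (fst (split l)) e"
      using val1[OF e(1)] lookup_deformation[OF l _ e(2)] e(1) by auto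
  qed
  moreover have "\<exists>q2. edge_potential Q (Poly_Mapping.lookup (snd (split l))) q2"
  proof (rule parallelogramic.restrict_potential[OF swapped q'])
    fix f g assume f: "f \<in> edge_set Q" "g \<in> edge_class Q P (Inl f)"
    show "Poly_Mapping.lookup l g = Poly_Mapping.lookup (snd (split l)) f"
      using val2[OF f(1)] lookup_deformation[OF l _ f(2)[unfolded edge_class_swap]] f(1) by auto
  qed
  moreover have "0 \<le> Poly_Mapping.lookup (fst (split l)) e" if "e \<in> edge_set P" for e
    using val1[OF that] pos rep_edge[of "Inl e"] that by auto
  moreover have "0 \<le> Poly_Mapping.lookup (snd (split l)) f" if "f \<in> edge_set Q" for f
    using val2[OF that] pos rep_edge[of "Inr f"] that by auto
  moreover have "Poly_Mapping.keys (fst (split l)) \<subseteq> edge_set P" "Poly_Mapping.keys (snd (split l)) \<subseteq> edge_set Q"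
    using finite_edges by (simp_all add: split_def keys_poly_mapping_on)
  ultimately show ?thesis
    by (simp add: mem_Times_iff deformation_cone_iff[OF P] deformation_cone_iff[OF Q])
qed

text \<open>Besides a preimage under \<open>split\<close>, its values on whole edge classes are
  recorded, since edge dependencies compare arbitrary edges and not only representatives.\<close>

lemma combine_deformation:
  assumes l1: "l1 \<in> deformation_cone P" and l2: "l2 \<in> deformation_cone Q"
  obtains l where "l \<in> deformation_cone (P + Q)" "split l = (l1, l2)"
    "\<forall>i\<in>index_set. \<forall>g\<in>edge_class P Q i.
       Poly_Mapping.lookup l g = case_sum (Poly_Mapping.lookup l1) (Poly_Mapping.lookup l2) i"
proof -
  define ix where "ix g = (THE i. i \<in> index_set \<and> g \<in> edge_class P Q i)" for g
  have ix: "ix g = i" if "i \<in> index_set" "g \<in> edge_class P Q i" for g i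
    unfolding ix_def using that edge_class_unique by (intro the_equality) blast+
  let ?val = "case_sum (Poly_Mapping.lookup l1) (Poly_Mapping.lookup l2)"
  define l where "l = poly_mapping_on (edge_set (P + Q)) (\<lambda>g. ?val (ix g))"
  have val: "Poly_Mapping.lookup l g = ?val i" if "i \<in> index_set" "g \<in> edge_class P Q i" for i g
  proof -
    have "g \<in> edge_set (P + Q)" using that edge_class_subset by blast
    then show ?thesis using ix[OF that] finite_edges by (simp add: l_def lookup_poly_mapping_on)
  qed
  have L1: "Poly_Mapping.keys l1 \<subseteq> edge_set P" "\<And>e. e \<in> edge_set P \<Longrightarrow> 0 \<le> Poly_Mapping.lookup l1 e"
    and L2: "Poly_Mapping.keys l2 \<subseteq> edge_set Q" "\<And>e. e \<in> edge_set Q \<Longrightarrow> 0 \<le> Poly_Mapping.lookup l2 e"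
    using l1 l2 deformation_cone_iff[OF P] deformation_cone_iff[OF Q] by auto
  obtain q1 q2 where "edge_potential P (Poly_Mapping.lookup l1) q1" "edge_potential Q (Poly_Mapping.lookup l2) q2"
    using l1 l2 deformation_cone_iff[OF P] deformation_cone_iff[OF Q] by auto
  then have "\<exists>q. edge_potential (P + Q) (Poly_Mapping.lookup l) q" using val by (rule extend_potential)
  moreover have "0 \<le> Poly_Mapping.lookup l g" if g: "g \<in> edge_set (P + Q)" for g
  proof -
    obtain i where i: "i \<in> index_set" "g \<in> edge_class P Q i" using edge_class_cover[OF g] .
    then show ?thesis using val[OF i] L1(2) L2(2) by auto
  qed
  ultimately have "l \<in> deformation_cone (P + Q)"
    unfolding deformation_cone_iff[OF polytope_sum] l_def
    using keys_poly_mapping_on[OF finite_edges(3)] by blast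
  moreover have "split l = (l1, l2)"
  proof -
    have "Poly_Mapping.lookup (fst (split l)) e = Poly_Mapping.lookup l1 e" for e
      using val[OF _ rep, of "Inl e"] L1(1) finite_edges
      by (auto simp: split_def lookup_poly_mapping_on in_keys_iff)
    moreover have "Poly_Mapping.lookup (snd (split l)) f = Poly_Mapping.lookup l2 f" for f
      using val[OF _ rep, of "Inr f"] L2(1) finite_edges
      by (auto simp: split_def lookup_poly_mapping_on in_keys_iff)
    ultimately show ?thesis by (simp add: prod_eq_iff poly_mapping_eqI)
  qed
  ultimately show ?thesis using that val by blast
qed

text \<open>Having support in the edges and being constant on classes are linear conditions, so they
  pass from the cone to its span. A vector satisfying them is determined by its values on
  representatives.\<close>

lemma inj_on_split: "inj_on split (span (deformation_cone (P + Q)))"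
proof -
  define W where "W = {l :: 'a set \<Rightarrow>\<^sub>0 real. (\<forall>g. g \<notin> edge_set (P + Q) \<longrightarrow> Poly_Mapping.lookup l g = 0) \<and>
    (\<forall>i\<in>index_set. \<forall>g\<in>edge_class P Q i. Poly_Mapping.lookup l g = Poly_Mapping.lookup l (rep i))}"
  have "subspace W"
    by (auto simp: subspace_def W_def lookup_add lookup_scaleR)
  moreover have "deformation_cone (P + Q) \<subseteq> W"
  proof
    fix l assume l: "l \<in> deformation_cone (P + Q)"
    then have "Poly_Mapping.keys l \<subseteq> edge_set (P + Q)" by (simp add: deformation_cone_iff[OF polytope_sum])
    then show "l \<in> W" using lookup_deformation[OF l] by (auto simp: W_def in_keys_iff)
  qed
  ultimately have "span (deformation_cone (P + Q)) \<subseteq> W" by (rule span_minimal[rotated])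
  moreover have "inj_on split W"
  proof (rule inj_onI)
    fix l l' assume l: "l \<in> W" "l' \<in> W" "split l = split l'"
    show "l = l'"
    proof (rule poly_mapping_eqI)
      fix g
      show "Poly_Mapping.lookup l g = Poly_Mapping.lookup l' g"
      proof (cases "g \<in> edge_set (P + Q)")
        case True
        then obtain i where i: "i \<in> index_set" "g \<in> edge_class P Q i" using edge_class_cover by blast
        then have "Poly_Mapping.lookup l g = Poly_Mapping.lookup l (rep i)"
          "Poly_Mapping.lookup l' g = Poly_Mapping.lookup l' (rep i)" using l W_def by blast+
        then show ?thesis using lookup_split[OF i(1)] l(3) by metis
      qed (use l W_def in auto)
    qed
  qed
  ultimately show ?thesis using inj_on_subset by blast
qed

lemma split_isomorphism:
  "linear_cone_isomorphism split (deformation_cone (P + Q)) (deformation_cone P \<times> deformation_cone Q)"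
  unfolding linear_cone_isomorphism_def
proof (intro conjI linear_split inj_on_split equalityI subsetI)
  fix z assume "z \<in> split ` deformation_cone (P + Q)"
  then show "z \<in> deformation_cone P \<times> deformation_cone Q" using split_deformation by blast
next
  fix z assume "z \<in> deformation_cone P \<times> deformation_cone Q"
  then obtain l1 l2 where z: "z = (l1, l2)" "l1 \<in> deformation_cone P" "l2 \<in> deformation_cone Q" by blast
  obtain l where "l \<in> deformation_cone (P + Q)" "split l = (l1, l2)"
    by (rule combine_deformation[OF z(2,3)])
  then show "z \<in> split ` deformation_cone (P + Q)" using z(1) by (metis image_eqI)
qed

section \<open>The quotient by edge classes\<close>

lemma same_edge_class_Image:
  assumes "i \<in> index_set" "g \<in> edge_class P Q i"
  shows "same_edge_class P Q `` {g} = edge_class P Q i"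
  using assms edge_class_unique[OF assms(1) _ assms(2)] unfolding same_edge_class_def by blast

lemma equiv_same_edge_class: "equiv (edge_set (P + Q)) (same_edge_class P Q)"
proof (rule equivI)
  show "same_edge_class P Q \<subseteq> edge_set (P + Q) \<times> edge_set (P + Q)"
    using edge_class_subset unfolding same_edge_class_def by blast
  show "refl_on (edge_set (P + Q)) (same_edge_class P Q)"
  proof (rule refl_onI)
    fix g assume "g \<in> edge_set (P + Q)"
    then obtain i where "i \<in> index_set" "g \<in> edge_class P Q i" by (rule edge_class_cover)
    then show "(g, g) \<in> same_edge_class P Q" unfolding same_edge_class_def by blast
  qed
  show "sym (same_edge_class P Q)" unfolding same_edge_class_def sym_def by blast
  show "trans (same_edge_class P Q)"
  proof (rule transI)
    fix x y z assume "(x, y) \<in> same_edge_class P Q" "(y, z) \<in> same_edge_class P Q"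
    then obtain i j where ij: "i \<in> index_set" "x \<in> edge_class P Q i" "y \<in> edge_class P Q i"
      "j \<in> index_set" "y \<in> edge_class P Q j" "z \<in> edge_class P Q j"
      unfolding same_edge_class_def by blast
    then have "i = j" using edge_class_unique by blast
    then show "(x, z) \<in> same_edge_class P Q" unfolding same_edge_class_def using ij by blast
  qed
qed

lemma inj_on_edge_class: "inj_on (edge_class P Q) index_set"
proof (rule inj_onI)
  fix i j assume ij: "i \<in> index_set" "j \<in> index_set" "edge_class P Q i = edge_class P Q j"
  then show "i = j" using edge_class_unique[OF ij(1,2), of "rep i"] rep[OF ij(1)] by simp
qed

lemma bij_betw_edge_class:
  "bij_betw (edge_class P Q) index_set (edge_set (P + Q) // same_edge_class P Q)"
proof -
  have "edge_class P Q ` index_set = edge_set (P + Q) // same_edge_class P Q"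
  proof (intro equalityI subsetI)
    fix C assume "C \<in> edge_class P Q ` index_set"
    then obtain i where i: "i \<in> index_set" "C = edge_class P Q i" by blast
    then have "C = same_edge_class P Q `` {rep i}" using same_edge_class_Image[OF i(1) rep[OF i(1)]] by simp
    then show "C \<in> edge_set (P + Q) // same_edge_class P Q" using quotientI[OF rep_edge[OF i(1)]] by simp
  next
    fix C assume "C \<in> edge_set (P + Q) // same_edge_class P Q"
    then obtain g where g: "g \<in> edge_set (P + Q)" "C = same_edge_class P Q `` {g}" by (rule quotientE)
    obtain i where i: "i \<in> index_set" "g \<in> edge_class P Q i" using edge_class_cover[OF g(1)] .
    then show "C \<in> edge_class P Q ` index_set" using same_edge_class_Image[OF i] g(2) by simp
  qed
  then show ?thesis using inj_on_edge_class by (simp add: bij_betw_def)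
qed

section \<open>Edge dependencies of the sum\<close>

lemma dependent_iff:
  assumes i: "i \<in> index_set" "g \<in> edge_class P Q i" and j: "j \<in> index_set" "h \<in> edge_class P Q j"
  shows "(\<forall>l\<in>deformation_cone (P + Q). Poly_Mapping.lookup l g = Poly_Mapping.lookup l h) \<longleftrightarrow>
    (\<forall>l1\<in>deformation_cone P. \<forall>l2\<in>deformation_cone Q.
      case_sum (Poly_Mapping.lookup l1) (Poly_Mapping.lookup l2) i = case_sum (Poly_Mapping.lookup l1) (Poly_Mapping.lookup l2) j)"
    (is "?lhs \<longleftrightarrow> ?rhs")
proof
  assume lhs: ?lhs
  show ?rhs
  proof (intro ballI)
    fix l1 l2 assume l12: "l1 \<in> deformation_cone P" "l2 \<in> deformation_cone Q"
    obtain l where l: "l \<in> deformation_cone (P + Q)" "split l = (l1, l2)"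
      and val: "\<forall>i\<in>index_set. \<forall>g\<in>edge_class P Q i.
       Poly_Mapping.lookup l g = case_sum (Poly_Mapping.lookup l1) (Poly_Mapping.lookup l2) i"
      by (rule combine_deformation[OF l12])
    show "case_sum (Poly_Mapping.lookup l1) (Poly_Mapping.lookup l2) i = case_sum (Poly_Mapping.lookup l1) (Poly_Mapping.lookup l2) j"
      using val i j lhs l(1) by metis
  qed
next
  assume rhs: ?rhs
  show ?lhs
  proof
    fix l assume l: "l \<in> deformation_cone (P + Q)"
    have "fst (split l) \<in> deformation_cone P" "snd (split l) \<in> deformation_cone Q"
      using split_deformation[OF l] by (simp_all add: mem_Times_iff)
    from rhs[rule_format, OF this]
    have "Poly_Mapping.lookup l (rep i) = Poly_Mapping.lookup l (rep j)"
      by (simp only: lookup_split[OF i(1)] lookup_split[OF j(1)])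
    then show "Poly_Mapping.lookup l g = Poly_Mapping.lookup l h"
      using lookup_deformation[OF l i] lookup_deformation[OF l j] by simp
  qed
qed

text \<open>For two indices on the same side, the vector of the other side does not occur and zero
  serves as an instance of it. Indices on different sides are never dependent, since the two vectors
  vary independently.\<close>

lemma dependent_iff_arc:
  assumes i: "i \<in> index_set" and j: "j \<in> index_set"
  shows "(\<forall>l1\<in>deformation_cone P. \<forall>l2\<in>deformation_cone Q.
      case_sum (Poly_Mapping.lookup l1) (Poly_Mapping.lookup l2) i = case_sum (Poly_Mapping.lookup l1) (Poly_Mapping.lookup l2) j)
    \<longleftrightarrow> (i, j) \<in> snd (disjoint_union_graph (edge_dependencies P) (edge_dependencies Q))"
proof -
  note zero = zero_in_deformation_cone[OF P] zero_in_deformation_cone[OF Q]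
  \<comment> \<open>All lengths one on \<open>P\<close> against the zero vector on \<open>Q\<close>
    separates every edge of \<open>P\<close> from every edge of \<open>Q\<close>.\<close>
  have one: "\<exists>l1\<in>deformation_cone P. \<exists>l2\<in>deformation_cone Q. Poly_Mapping.lookup l1 e \<noteq> Poly_Mapping.lookup l2 f"
    if "e \<in> edge_set P" for e f
    using ones_in_deformation_cone[OF P] zero(2) that finite_edges(1)
    by (intro bexI[of _ "poly_mapping_on (edge_set P) (\<lambda>_. 1)"] bexI[of _ 0]) (simp_all add: lookup_poly_mapping_on)
  let ?D = "snd (disjoint_union_graph (edge_dependencies P) (edge_dependencies Q))"
  have arcs: "(Inl e, Inl f) \<in> ?D \<longleftrightarrow> e \<in> edge_set P \<and> f \<in> edge_set P \<and>
      (\<forall>l\<in>deformation_cone P. Poly_Mapping.lookup l e = Poly_Mapping.lookup l f)"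
    "(Inr e, Inr f) \<in> ?D \<longleftrightarrow> e \<in> edge_set Q \<and> f \<in> edge_set Q \<and>
      (\<forall>l\<in>deformation_cone Q. Poly_Mapping.lookup l e = Poly_Mapping.lookup l f)"
    "(Inl e, Inr f) \<notin> ?D" "(Inr f, Inl e) \<notin> ?D" for e f
    by (auto simp: disjoint_union_graph_def edge_dependencies_def)
  show ?thesis
  proof (cases i)
    case i': (Inl e)
    show ?thesis
    proof (cases j)
      case (Inl f)
      then show ?thesis using i i' j zero by (simp add: arcs) blast
    next
      case (Inr f)
      then show ?thesis using i i' j one[of e f] by (simp add: arcs) blast
    qed
  next
    case i': (Inr e)
    show ?thesis
    proof (cases j)
      case (Inl f)
      then have "f \<in> edge_set P" using j by auto
      then show ?thesis using one[of f e] Inl i' by (simp add: arcs) metis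
    next
      case (Inr f)
      then show ?thesis using i i' j zero by (simp add: arcs) blast
    qed
  qed
qed

lemma edge_dependencies_sum:
  "edge_dependencies (P + Q) =
     lift_graph (edge_set (P + Q)) (same_edge_class P Q)
       (relabel_graph (edge_class P Q)
         (disjoint_union_graph (edge_dependencies P) (edge_dependencies Q)))"
proof -
  let ?D = "snd (disjoint_union_graph (edge_dependencies P) (edge_dependencies Q))"
  let ?C = "edge_class P Q" and ?r = "same_edge_class P Q"
  have D: "?D \<subseteq> index_set \<times> index_set"
    by (auto simp: disjoint_union_graph_def edge_dependencies_def)
  have "(\<forall>l\<in>deformation_cone (P + Q). Poly_Mapping.lookup l g = Poly_Mapping.lookup l h) \<longleftrightarrow>
      (?r `` {g}, ?r `` {h}) \<in> map_prod ?C ?C ` ?D"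
    if gh: "g \<in> edge_set (P + Q)" "h \<in> edge_set (P + Q)" for g h
  proof -
    obtain i where i: "i \<in> index_set" "g \<in> ?C i" using edge_class_cover[OF gh(1)] .
    obtain j where j: "j \<in> index_set" "h \<in> ?C j" using edge_class_cover[OF gh(2)] .
    have "(?r `` {g}, ?r `` {h}) \<in> map_prod ?C ?C ` ?D \<longleftrightarrow> (?C i, ?C j) \<in> map_prod ?C ?C ` ?D"
      using same_edge_class_Image i j by simp
    \<comment> \<open>Distinct indices have distinct classes, so the relabelling merges no nodes and
      creates no arcs.\<close>
    also have "\<dots> \<longleftrightarrow> (i, j) \<in> ?D"
    proof
      assume "(?C i, ?C j) \<in> map_prod ?C ?C ` ?D"
      then obtain i' j' where ij': "(i', j') \<in> ?D" "?C i = ?C i'" "?C j = ?C j'" by auto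
      then have "i' \<in> index_set" "j' \<in> index_set" using D by blast+
      then have "i = i'" "j = j'"
        using inj_onD[OF inj_on_edge_class] ij'(2,3) i(1) j(1) by blast+
      then show "(i, j) \<in> ?D" using ij'(1) by simp
    next
      assume "(i, j) \<in> ?D"
      then have "map_prod ?C ?C (i, j) \<in> map_prod ?C ?C ` ?D" by (rule imageI)
      then show "(?C i, ?C j) \<in> map_prod ?C ?C ` ?D" by (simp only: map_prod_simp)
    qed
    finally show ?thesis
      using dependent_iff[OF i j, unfolded dependent_iff_arc[OF i(1) j(1)]] by simp
  qed
  then show ?thesis
    by (simp add: edge_dependencies_def[of "P + Q"] lift_graph_def relabel_graph_def cong: conj_cong)
qed

end

theorem theorem4p3p2:
  fixes P Q :: "'a::euclidean_space set"
  assumes "polytope P" and "P \<noteq> {}"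
    and "polytope Q" and "Q \<noteq> {}"
    and "parallelogramic_position P Q"
  shows "(\<exists>\<Phi>. linear_cone_isomorphism \<Phi>
             (deformation_cone (P + Q)) (deformation_cone P \<times> deformation_cone Q)) \<and>
         equiv (edge_set (P + Q)) (same_edge_class P Q) \<and>
         bij_betw (edge_class P Q) (edge_set P <+> edge_set Q)
           (edge_set (P + Q) // same_edge_class P Q) \<and>
         edge_dependencies (P + Q) =
           lift_graph (edge_set (P + Q)) (same_edge_class P Q)
             (relabel_graph (edge_class P Q)
               (disjoint_union_graph (edge_dependencies P) (edge_dependencies Q)))"
proof -
  interpret parallelogramic P Q
    by (rule parallelogramic.intro) (fact assms)+
  show ?thesis
    using split_isomorphism equiv_same_edge_class bij_betw_edge_class edge_dependencies_sum by blast
qed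

end
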